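(* Let $(X,U)$ be an innovation and let $(\alpha,\beta,\epsilon)$ be damping parameters with $0\le\alpha<\sqrt\beta<1$ and $\epsilon\in(0,\infty)$. Let $\theta\in\mathbb R^d$ and $i\in\{1,\dots,d\}$ and suppose that $$X_0^{\theta,(i)}\in L^5\quad\text{and}\quad V(\mathbf X^{\theta,(i)})^{-1/2}\in L^3.$$ Then the first order approximation $\tilde f^{(i)}(\theta)$ for the Adam vector field with innovation $(X,U)$ and damping parameters $(\alpha,\beta,\epsilon)$ is well-defined in $\theta$ and $i$, and $$|f^{(i)}(\theta)-\tilde f^{(i)}(\theta)|\le\frac38\,\frac{(1-\alpha)(1-\beta)^2}{\beta^{5/2}(1-\alpha\beta^2)}\,\mathbb E\Bigl[\frac1{(\sqrt{V(\mathbf X^{\theta,(i)})}+\epsilon)^2\,V(\mathbf X^{\theta,(i)})^{3/2}}\Bigr]\,\mathbb E\bigl[|X_0^{\theta,(i)}|^5\bigr].$$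
   Context: An innovation is a pair $(X,U)$ of a random variable $U$ with values in a measurable space $\mathcal U$ and a product measurable map $X\colon\mathcal U\times\mathbb R^d\to\mathbb R^d$. Let $(U_k)_{k\in-\mathbb N_0}$ be i.i.d. copies of $U$; $X_k^\theta=X(U_k,\theta)$, $\mathbf X^\theta=(X_k^\theta)_{k\in-\mathbb N_0}$, superscript $(i)$ denotes the $i$-th component, so $\mathbf X^{\theta,(i)}=(X_k^{\theta,(i)})_{k\in-\mathbb N_0}$. For a real sequence $\mathbf x=(x_k)_{k\in-\mathbb N_0}$ set $$V(\mathbf x)=(1-\beta)\sum_{k\in-\mathbb N_0}\beta^{-k}x_k^2,\qquad V^{\neq k}(\mathbf x)=(1-\beta)\sum_{r\in-\mathbb N_0\setminus\{k\}}\beta^{-r}x_r^2.$$ The Adam vector field $f$ is $$f^{(i)}(\theta)=(1-\alpha)\,\mathbb E\Bigl[\frac1{\sqrt{V(\mathbf X^{\theta,(i)})}+\epsilon}\sum_{k\in-\mathbb N_0}\alpha^{-k}X_k^{\theta,(i)}\Bigr].$$ The first order approximation is $$\tilde f^{(i)}(\theta)=(1-\alpha)\sum_{k\in-\mathbb N_0}\alpha^{-k}\,\mathbb E\Bigl[\frac1{\sqrt{V^{\neq k}(\mathbf X^{\theta,(i)})}+\epsilon}\Bigr]\mathbb E[X_0^{\theta,(i)}]$$ $$\qquad-(1-\alpha)(1-\beta)\sum_{k\in-\mathbb N_0}(\alpha\beta)^{-k}\,\mathbb E\Bigl[\frac1{(\sqrt{V^{\neq k}(\mathbf X^{\theta,(i)})}+\epsilon)^2}\,\frac1{2\sqrt{V^{\neq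 k}(\mathbf X^{\theta,(i)})}}\Bigr]\mathbb E\bigl[(X_0^{\theta,(i)})^3\bigr],$$ called well-defined if the expectations are well-defined and finite. Convention: $0^0=1$. *)

theory Defs
  imports "HOL-Probability.Probability"
begin

text \<open>
  Sequences indexed by \<open>-\<nat>\<^sub>0\<close> are represented by functions on \<^typ>\<open>nat\<close>: the argument \<open>n\<close>
  stands for the time index \<open>k = -n\<close>, so that \<open>\<beta>\<close> to the power \<open>-k\<close> becomes \<open>\<beta> ^ n\<close>.
  The Euclidean space of dimension \<open>d\<close> is \<open>real ^ 'd\<close> with components indexed by \<open>'d\<close>.
\<close>

definition innovation ::
  "'w measure \<Rightarrow> 'u measure \<Rightarrow> ('u \<times> (real ^ 'd) \<Rightarrow> (real ^ 'd)) \<Rightarrow> ('w \<Rightarrow> 'u) \<Rightarrow> bool" where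
  "innovation N \<U> X U \<longleftrightarrow>
     prob_space N \<and> U \<in> measurable N \<U> \<and> X \<in> borel_measurable (\<U> \<Otimes>\<^sub>M borel)"

text \<open>The copies may live on another probability space \<open>M\<close> than \<open>U\<close> itself.\<close>

definition iid_copies ::
  "'a measure \<Rightarrow> 'u measure \<Rightarrow> (nat \<Rightarrow> 'a \<Rightarrow> 'u) \<Rightarrow> 'w measure \<Rightarrow> ('w \<Rightarrow> 'u) \<Rightarrow> bool" where
  "iid_copies M \<U> Us N U \<longleftrightarrow>
     prob_space M \<and> prob_space.indep_vars M (\<lambda>_. \<U>) Us UNIV \<and>
     (\<forall>k. distr M \<U> (Us k) = distr N \<U> U)"

definition innov_seq ::
  "('u \<times> (real ^ 'd) \<Rightarrow> (real ^ 'd)) \<Rightarrow> (nat \<Rightarrow> 'a \<Rightarrow> 'u) \<Rightarrow> (real ^ 'd) \<Rightarrow> 'd \<Rightarrow> 'a \<Rightarrow> nat \<Rightarrow> real" where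
  "innov_seq X Us \<theta> i \<omega> k = X (Us k \<omega>, \<theta>) $ i"

text \<open>
  The next two series are only meaningful where they converge.  For an i.i.d. sequence of
  square integrable variables and \<open>0 \<le> \<beta> < 1\<close> this is the case almost surely, hence the
  unspecified value of \<^const>\<open>suminf\<close> at divergent series never enters an expectation below.
\<close>

definition V :: "real \<Rightarrow> (nat \<Rightarrow> real) \<Rightarrow> real" where
  "V \<beta> x = (1 - \<beta>) * (\<Sum>k. \<beta> ^ k * (x k)\<^sup>2)"

definition V_except :: "real \<Rightarrow> nat \<Rightarrow> (nat \<Rightarrow> real) \<Rightarrow> real" where
  "V_except \<beta> k x = (1 - \<beta>) * (\<Sum>r. if r = k then 0 else \<beta> ^ r * (x r)\<^sup>2)"

text \<open>
  Extended real values make \<open>V\<close> to the power \<open>-1/2\<close> equal to \<open>\<infinity>\<close> where \<open>V\<close> vanishes, so that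
  its membership in \<open>L\<^sup>p\<close> forces \<open>V > 0\<close> almost surely (the real quotient \<open>1 / 0\<close> would be \<open>0\<close>).
\<close>

definition in_L :: "nat \<Rightarrow> 'a measure \<Rightarrow> ('a \<Rightarrow> ereal) \<Rightarrow> bool" where
  "in_L p M g \<longleftrightarrow> g \<in> borel_measurable M \<and> (\<integral>\<^sup>+ \<omega>. e2ennreal \<bar>g \<omega>\<bar> ^ p \<partial>M) < \<infinity>"

definition adam_field ::
  "'a measure \<Rightarrow> real \<Rightarrow> real \<Rightarrow> real \<Rightarrow> ('u \<times> (real ^ 'd) \<Rightarrow> (real ^ 'd)) \<Rightarrow> (nat \<Rightarrow> 'a \<Rightarrow> 'u) \<Rightarrow>
    (real ^ 'd) \<Rightarrow> 'd \<Rightarrow> real" where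
  "adam_field M \<alpha> \<beta> \<epsilon> X Us \<theta> i =
     (1 - \<alpha>) * (\<integral>\<omega>. 1 / (sqrt (V \<beta> (innov_seq X Us \<theta> i \<omega>)) + \<epsilon>) *
       (\<Sum>k. \<alpha> ^ k * innov_seq X Us \<theta> i \<omega> k) \<partial>M)"

text \<open>
  The expectation in the second series of the first order approximation.  Its integrand has a
  singularity where \<open>V_except\<close> vanishes; dividing in \<^typ>\<open>ennreal\<close> assigns the value \<open>\<infinity>\<close> there.
\<close>

definition second_expectation ::
  "'a measure \<Rightarrow> real \<Rightarrow> real \<Rightarrow> ('u \<times> (real ^ 'd) \<Rightarrow> (real ^ 'd)) \<Rightarrow> (nat \<Rightarrow> 'a \<Rightarrow> 'u) \<Rightarrow>
    (real ^ 'd) \<Rightarrow> 'd \<Rightarrow> nat \<Rightarrow> ennreal" where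
  "second_expectation M \<beta> \<epsilon> X Us \<theta> i k =
     (\<integral>\<^sup>+ \<omega>. ennreal (1 / (sqrt (V_except \<beta> k (innov_seq X Us \<theta> i \<omega>)) + \<epsilon>)\<^sup>2) *
       (1 / ennreal (2 * sqrt (V_except \<beta> k (innov_seq X Us \<theta> i \<omega>)))) \<partial>M)"

definition first_order_approx ::
  "'a measure \<Rightarrow> real \<Rightarrow> real \<Rightarrow> real \<Rightarrow> ('u \<times> (real ^ 'd) \<Rightarrow> (real ^ 'd)) \<Rightarrow> (nat \<Rightarrow> 'a \<Rightarrow> 'u) \<Rightarrow>
    (real ^ 'd) \<Rightarrow> 'd \<Rightarrow> real" where
  "first_order_approx M \<alpha> \<beta> \<epsilon> X Us \<theta> i =
     (1 - \<alpha>) * (\<Sum>k. \<alpha> ^ k *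
         (\<integral>\<omega>. 1 / (sqrt (V_except \<beta> k (innov_seq X Us \<theta> i \<omega>)) + \<epsilon>) \<partial>M) *
         (\<integral>\<omega>. innov_seq X Us \<theta> i \<omega> 0 \<partial>M))
     - (1 - \<alpha>) * (1 - \<beta>) * (\<Sum>k. (\<alpha> * \<beta>) ^ k *
         enn2real (second_expectation M \<beta> \<epsilon> X Us \<theta> i k) *
         (\<integral>\<omega>. (innov_seq X Us \<theta> i \<omega> 0) ^ 3 \<partial>M))"

text \<open>
  For i.i.d. copies, \<open>0 \<le> \<alpha> < 1\<close>, \<open>0 < \<beta> < 1\<close> and \<open>\<epsilon> > 0\<close>, finiteness of the expectations
  already implies that both series in \<^const>\<open>first_order_approx\<close> converge: the first expectation is
  at most \<open>1 / \<epsilon>\<close>, and the second one is largest for \<open>k = 0\<close>, because \<open>V_except\<close> at \<open>0\<close> is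
  stochastically dominated by \<open>V_except\<close> at \<open>k\<close>.
\<close>

definition first_order_approx_well_defined ::
  "'a measure \<Rightarrow> real \<Rightarrow> real \<Rightarrow> ('u \<times> (real ^ 'd) \<Rightarrow> (real ^ 'd)) \<Rightarrow> (nat \<Rightarrow> 'a \<Rightarrow> 'u) \<Rightarrow>
    (real ^ 'd) \<Rightarrow> 'd \<Rightarrow> bool" where
  "first_order_approx_well_defined M \<beta> \<epsilon> X Us \<theta> i \<longleftrightarrow>
     (\<forall>k. integrable M (\<lambda>\<omega>. 1 / (sqrt (V_except \<beta> k (innov_seq X Us \<theta> i \<omega>)) + \<epsilon>))) \<and>
     (\<forall>k. second_expectation M \<beta> \<epsilon> X Us \<theta> i k < \<infinity>) \<and>
     integrable M (\<lambda>\<omega>. innov_seq X Us \<theta> i \<omega> 0) \<and>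
     integrable M (\<lambda>\<omega>. (innov_seq X Us \<theta> i \<omega> 0) ^ 3)"

end

theory Submission
  imports Defs
begin

text \<open>
  Let \<open>g(v) = 1 / (sqrt v + \<epsilon>)\<close>. In the \<open>k\<close>-th summand of the Adam field,
  \<open>V = V_except k + (1 - \<beta>) \<beta>\<^sup>k X\<^sub>k\<^sup>2\<close>, and \<open>X\<^sub>k\<close> is independent of \<open>V_except k\<close>. Expanding \<open>g\<close> to
  first order at \<open>V_except k\<close>, taking expectations and using independence yields the \<open>k\<close>-th terms of
  the first order approximation; the remainder is at most \<open>3/8 (1 - \<beta>)\<^sup>2 \<beta>\<^sup>2\<^sup>k E|X\<^sub>0|\<^sup>5 E \<phi>(V_except k)\<close>
  with \<open>\<phi>(v) = 1 / ((sqrt v + \<epsilon>)\<^sup>2 v\<^sup>3\<^sup>/\<^sup>2)\<close>. Omitting the \<open>k\<close>-th variable and closing the gap gives an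
  i.i.d. sequence with the same law, whose \<open>V\<close> satisfies \<open>\<beta> V \<le> V_except k\<close>. As \<open>\<phi>\<close> is decreasing
  and \<open>\<phi>(\<beta> v) \<le> \<beta>\<^sup>-\<^sup>5\<^sup>/\<^sup>2 \<phi>(v)\<close>, this bounds \<open>E \<phi>(V_except k)\<close> by \<open>\<beta>\<^sup>-\<^sup>5\<^sup>/\<^sup>2 E \<phi>(V)\<close>, and the geometric
  series over \<open>k\<close> gives the constant.
\<close>

subsection \<open>The function \<open>v \<mapsto> 1 / (sqrt v + \<epsilon>)\<close>\<close>

definition gain :: "real \<Rightarrow> real \<Rightarrow> real" where
  "gain \<epsilon> v = 1 / (sqrt v + \<epsilon>)"

text \<open>
  Up to sign and a factor, the next two functions are the first derivative of \<open>gain \<epsilon>\<close> and a bound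
  for the second one: \<open>gain_slope \<epsilon> = - (gain \<epsilon>)'\<close> and \<open>(gain \<epsilon>)'' \<le> 3 / 4 * gain_curv \<epsilon>\<close>.
\<close>

definition gain_slope :: "real \<Rightarrow> real \<Rightarrow> real" where
  "gain_slope \<epsilon> v = 1 / ((sqrt v + \<epsilon>)\<^sup>2 * (2 * sqrt v))"

definition gain_curv :: "real \<Rightarrow> real \<Rightarrow> real" where
  "gain_curv \<epsilon> v = 1 / ((sqrt v + \<epsilon>)\<^sup>2 * sqrt v ^ 3)"

lemma measurable_gain [measurable]:
  "gain \<epsilon> \<in> borel_measurable borel"
  "gain_slope \<epsilon> \<in> borel_measurable borel"
  "gain_curv \<epsilon> \<in> borel_measurable borel"
  unfolding gain_def[abs_def] gain_slope_def[abs_def] gain_curv_def[abs_def] by measurable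

lemma gain_bounds:
  assumes "0 < \<epsilon>" "0 \<le> v"
  shows "0 < gain \<epsilon> v" "gain \<epsilon> v \<le> 1 / \<epsilon>"
  unfolding gain_def using assms by (auto intro!: divide_pos_pos divide_left_mono mult_pos_pos add_nonneg_pos)

lemma gain_slope_nonneg: "0 < v \<Longrightarrow> 0 \<le> gain_slope \<epsilon> v"
  by (simp add: gain_slope_def)

lemma gain_curv_nonneg: "0 < v \<Longrightarrow> 0 \<le> gain_curv \<epsilon> v"
  by (simp add: gain_curv_def)

lemma gain_slope_antimono:
  assumes "0 < \<epsilon>" "0 < v" "v \<le> w"
  shows "gain_slope \<epsilon> w \<le> gain_slope \<epsilon> v"
proof -
  have "0 < w" "0 < sqrt v + \<epsilon>" "0 < sqrt w + \<epsilon>" using assms by (auto intro: add_pos_pos)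
  then show ?thesis
    unfolding gain_slope_def using assms
    by (intro divide_left_mono mult_mono power_mono mult_pos_pos zero_less_power) auto
qed

lemma gain_curv_antimono:
  assumes "0 < \<epsilon>" "0 < v" "v \<le> w"
  shows "gain_curv \<epsilon> w \<le> gain_curv \<epsilon> v"
proof -
  have "0 < w" "0 < sqrt v + \<epsilon>" "0 < sqrt w + \<epsilon>" using assms by (auto intro: add_pos_pos)
  then show ?thesis
    unfolding gain_curv_def using assms
    by (intro divide_left_mono mult_mono power_mono mult_pos_pos zero_less_power) auto
qed

text \<open>Bounding the first factor of the denominator below by \<open>\<epsilon>\<^sup>2\<close>
  leaves the third power of \<open>1 / sqrt v\<close>, which is the quantity that membership of the
  inverse square root of \<open>V\<close> in the third Lebesgue space controls.\<close>

lemma gain_curv_le: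
  assumes "0 < \<epsilon>" "0 < v"
  shows "gain_curv \<epsilon> v \<le> 1 / \<epsilon>\<^sup>2 * (1 / sqrt v ^ 3)"
proof -
  have "\<epsilon>\<^sup>2 * sqrt v ^ 3 \<le> (sqrt v + \<epsilon>)\<^sup>2 * sqrt v ^ 3"
    using assms by (intro mult_right_mono power_mono) auto
  moreover have "0 < sqrt v + \<epsilon>" using assms by (auto intro: add_pos_pos)
  ultimately show ?thesis
    unfolding gain_curv_def using assms by (simp add: frac_le)
qed

text \<open>As \<open>b \<le> 1\<close>, the summand \<open>\<epsilon>\<close> may be multiplied by
  \<open>sqrt b\<close> as well; then each of the five factors of the denominator releases one
  \<open>sqrt b\<close>.\<close>

lemma gain_curv_scale:
  assumes "0 < \<epsilon>" "0 < v" "0 < b" "b \<le> 1"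
  shows "gain_curv \<epsilon> (b * v) \<le> 1 / sqrt b ^ 5 * gain_curv \<epsilon> v"
proof -
  have pos: "0 < sqrt v + \<epsilon>" "0 < sqrt b * sqrt v + \<epsilon>" "0 < sqrt b" "0 < sqrt v"
    using assms by (auto intro: add_pos_pos)
  have "sqrt b * (sqrt v + \<epsilon>) \<le> sqrt b * sqrt v + \<epsilon>"
    using assms by (simp add: distrib_left mult_left_le_one_le)
  then have "(sqrt b * (sqrt v + \<epsilon>))\<^sup>2 \<le> (sqrt b * sqrt v + \<epsilon>)\<^sup>2"
    using pos by (intro power_mono) auto
  then have "(sqrt b * (sqrt v + \<epsilon>))\<^sup>2 * (sqrt b * sqrt v) ^ 3
      \<le> (sqrt b * sqrt v + \<epsilon>)\<^sup>2 * (sqrt b * sqrt v) ^ 3"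
    using pos by (intro mult_right_mono) auto
  then have "1 / ((sqrt b * sqrt v + \<epsilon>)\<^sup>2 * (sqrt b * sqrt v) ^ 3)
      \<le> 1 / ((sqrt b * (sqrt v + \<epsilon>))\<^sup>2 * (sqrt b * sqrt v) ^ 3)"
    using pos by (intro divide_left_mono mult_pos_pos zero_less_power) auto
  also have "\<dots> = 1 / sqrt b ^ 5 * gain_curv \<epsilon> v"
    unfolding gain_curv_def
    by (simp add: power_mult_distrib power2_eq_square eval_nat_numeral mult_ac)
  finally show ?thesis
    unfolding gain_curv_def by (simp add: real_sqrt_mult)
qed

text \<open>The singularity at zero is of order \<open>1 / sqrt v\<close>. It is dominated by the
  third power for small \<open>v\<close> and by 1 otherwise, so the same moment of \<open>V\<close>
  serves here and for \<open>gain_curv\<close>.\<close>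

lemma gain_slope_le:
  assumes "0 < \<epsilon>" "0 < v"
  shows "gain_slope \<epsilon> v \<le> 1 / \<epsilon>\<^sup>2 * (1 + 1 / sqrt v ^ 3)"
proof -
  have pos: "0 < sqrt v + \<epsilon>" "0 < sqrt v"
    using assms by (auto intro: add_pos_pos)
  have "\<epsilon>\<^sup>2 * sqrt v \<le> (sqrt v + \<epsilon>)\<^sup>2 * (2 * sqrt v)"
    using assms by (intro mult_mono power_mono) auto
  then have "gain_slope \<epsilon> v \<le> 1 / (\<epsilon>\<^sup>2 * sqrt v)"
    unfolding gain_slope_def using assms by (intro frac_le) simp_all
  also have "\<dots> = 1 / \<epsilon>\<^sup>2 * (1 / sqrt v)" by simp
  also have "\<dots> \<le> 1 / \<epsilon>\<^sup>2 * (1 + 1 / sqrt v ^ 3)"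
  proof (intro mult_left_mono)
    show "1 / sqrt v \<le> 1 + 1 / sqrt v ^ 3"
    proof (cases "sqrt v \<le> 1")
      case True
      then have "sqrt v ^ 3 \<le> sqrt v ^ 1"
        using pos by (intro power_decreasing) auto
      then have "1 / sqrt v \<le> 1 / sqrt v ^ 3"
        using pos by (intro divide_left_mono) auto
      then show ?thesis by simp
    next
      case False
      then have "1 / sqrt v \<le> 1" by simp
      then show ?thesis using pos by (intro add_increasing2) auto
    qed
  qed simp
  finally show ?thesis .
qed

text \<open>In terms of the square roots \<open>a\<close> and \<open>b\<close> of the two arguments
  the increment is \<open>h = b\<^sup>2 - a\<^sup>2\<close>, and the remainder is a rational
  function that can be factored exactly. No differentiation is involved.\<close>

lemma gain_taylor:
  fixes v h \<epsilon> :: real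
  assumes "0 < v" "0 \<le> h" "0 < \<epsilon>"
  shows "\<bar>gain \<epsilon> (v + h) - gain \<epsilon> v + h * gain_slope \<epsilon> v\<bar> \<le> 3 / 8 * h\<^sup>2 * gain_curv \<epsilon> v"
proof -
  define a b A B where "a = sqrt v" and "b = sqrt (v + h)" and "A = a + \<epsilon>" and "B = b + \<epsilon>"
  have a: "0 < a" and ab: "a \<le> b" and h: "h = b\<^sup>2 - a\<^sup>2" and AB: "a < A" "b < B" "A \<le> B"
    using assms by (auto simp: a_def b_def A_def B_def)
  then have pos: "0 < A" "0 < B" "0 < b" by linarith+
  have "1 / B - 1 / A + h * (1 / (A\<^sup>2 * (2 * a))) = (b - a)\<^sup>2 / (2 * a * A\<^sup>2) * (1 + 2 * a / B)"
  proof -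
    have BA: "B = A + b - a" by (simp add: A_def B_def)
    have "1 / B - 1 / A + h * (1 / (A\<^sup>2 * (2 * a))) = 
      (2 * a * A\<^sup>2 - 2 * a * A * B + h * B) / (2 * a * A\<^sup>2 * B)"
      using pos a by (simp add: field_simps power2_eq_square)
    \<comment> \<open>Both \<open>A - B = a - b\<close> and \<open>h = (b - a) * (b + a)\<close>
      contain the factor \<open>b - a\<close>; the cofactor \<open>(a + b) * B - 2 * a * A\<close>
      contains it once more.\<close>
    also have "2 * a * A\<^sup>2 - 2 * a * A * B + h * B = (b - a)\<^sup>2 * (B + 2 * a)"
      unfolding h BA by (simp add: power2_eq_square algebra_simps)
    finally show ?thesis
      using pos a by (simp add: field_simps power2_eq_square)
  qed
  moreover have "0 \<le> (b - a)\<^sup>2 / (2 * a * A\<^sup>2) * (1 + 2 * a / B)"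
    using pos a by simp
  moreover have "(b - a)\<^sup>2 / (2 * a * A\<^sup>2) * (1 + 2 * a / B) \<le> 3 / 8 * h\<^sup>2 * (1 / (A\<^sup>2 * a ^ 3))"
  proof -
    have "1 + 2 * a / B \<le> 3"
      using pos a ab AB by (simp add: field_simps)
    \<comment> \<open>The square of \<open>a + b\<close> is introduced in order to complete
      \<open>(b - a)\<^sup>2\<close> to \<open>h\<^sup>2\<close>. The quotient is at least 2, which
      gives \<open>3 / 4\<close>; with the \<open>1 / 2\<close> in front this is the constant
      \<open>3 / 8\<close>.\<close>
    also have "3 \<le> 3 / 4 * ((a + b) / a)\<^sup>2"
    proof -
      have "2 \<le> (a + b) / a" using a ab by (simp add: field_simps)
      from power_mono[OF this, of 2] show ?thesis by simp
    qed
    finally have "(b - a)\<^sup>2 / (2 * a * A\<^sup>2) * (1 + 2 * a / B)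
      \<le> (b - a)\<^sup>2 / (2 * a * A\<^sup>2) * (3 / 4 * ((a + b) / a)\<^sup>2)"
      using pos a by (intro mult_left_mono) simp_all
    also have "\<dots> = 3 / 8 * ((b - a) * (a + b))\<^sup>2 * (1 / (A\<^sup>2 * a ^ 3))"
      using pos a by (simp add: power_mult_distrib power_divide power2_eq_square power3_eq_cube mult_ac)
    also have "(b - a) * (a + b) = h"
      unfolding h by (simp add: power2_eq_square algebra_simps)
    finally show ?thesis .
  qed
  ultimately show ?thesis
    by (simp add: a_def b_def A_def B_def gain_def gain_slope_def gain_curv_def)
qed

subsection \<open>Omitting one index\<close>

lemma suminf_remove_index:
  fixes f :: "nat \<Rightarrow> real"
  assumes "summable f"
  shows "(\<Sum>r. if r = k then 0 else f r) = suminf f - f k"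
    and "summable (\<lambda>r. if r = k then 0 else f r)"
proof -
  have "(\<lambda>r. if r = k then f r else 0) sums f k"
    by (rule sums_single)
  from sums_diff[OF summable_sums[OF assms] this]
  have "(\<lambda>r. if r = k then 0 else f r) sums (suminf f - f k)"
    by (rule sums_cong[THEN iffD1, rotated]) auto
  then show "(\<Sum>r. if r = k then 0 else f r) = suminf f - f k"
    and "summable (\<lambda>r. if r = k then 0 else f r)"
    by (auto simp: sums_iff)
qed

text \<open>The increasing enumeration of all indices except \<open>k\<close>. Reading a sequence
  along it closes the gap left by the \<open>k\<close>-th entry.\<close>

definition skip :: "nat \<Rightarrow> nat \<Rightarrow> nat" where
  "skip k j = (if j < k then j else Suc j)"

lemma strict_mono_skip: "strict_mono (skip k)"
  by (auto simp: strict_mono_def skip_def)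

lemma inj_skip: "inj (skip k)"
  by (rule strict_mono_imp_inj_on[OF strict_mono_skip])

lemma range_skip: "range (skip k) = - {k}"
proof -
  have "r \<in> range (skip k)" if "r \<noteq> k" for r
    using that by (intro image_eqI[of _ _ "if r < k then r else r - 1"]) (auto simp: skip_def)
  then show ?thesis by (auto simp: skip_def)
qed

text \<open>Convergence is what allows one term to be split off; \<open>suminf\<close> of a
  divergent series is an unspecified number.\<close>

lemma V_eq_V_except:
  assumes "summable (\<lambda>k. \<beta> ^ k * (y k)\<^sup>2)"
  shows "V \<beta> y = V_except \<beta> k y + (1 - \<beta>) * (\<beta> ^ k * (y k)\<^sup>2)"
  using suminf_remove_index(1)[OF assms, of k]
  by (simp add: V_def V_except_def flip: distrib_left)

lemma V_nonneg:
  assumes "0 \<le> \<beta>" "\<beta> \<le> 1" "summable (\<lambda>k. \<beta> ^ k * (y k)\<^sup>2)"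
  shows "0 \<le> V \<beta> y"
  unfolding V_def using assms by (intro mult_nonneg_nonneg suminf_nonneg) auto

text \<open>Closing the gap moves an entry by at most one place: the entry of weight
  \<open>\<beta> ^ j\<close> after the shift had weight \<open>\<beta> ^ j\<close> or
  \<open>\<beta> ^ Suc j\<close> before. Hence at most one factor \<beta> is lost.\<close>

lemma V_except_ge:
  assumes \<beta>: "0 \<le> \<beta>" "\<beta> \<le> 1" and sm: "summable (\<lambda>k. \<beta> ^ k * (y k)\<^sup>2)"
  assumes sm': "summable (\<lambda>j. \<beta> ^ j * (y (skip k j))\<^sup>2)"
  shows "\<beta> * V \<beta> (\<lambda>j. y (skip k j)) \<le> V_except \<beta> k y"
proof -
  define f where "f r = (if r = k then 0 else \<beta> ^ r * (y r)\<^sup>2)" for r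
  \<comment> \<open>Vanishing off the range of \<open>skip k\<close> lets the sum of
    \<open>f\<close> be taken along \<open>skip k\<close>.\<close>
  have zero: "f r = 0" if "r \<notin> range (skip k)" for r
    using that by (simp add: range_skip f_def)
  have "summable f"
    unfolding f_def by (rule suminf_remove_index(2)[OF sm])
  then have "summable (\<lambda>j. f (skip k j))"
    using summable_mono_reindex[OF strict_mono_skip, of k f] zero by simp
  moreover have "\<beta> * (\<beta> ^ j * (y (skip k j))\<^sup>2) \<le> f (skip k j)" for j
  proof -
    have "\<beta> ^ Suc j \<le> \<beta> ^ skip k j"
      using \<beta> by (intro power_decreasing) (auto simp: skip_def)
    moreover have "skip k j \<noteq> k" by (simp add: skip_def)
    ultimately show ?thesis
      using mult_right_mono[of "\<beta> ^ Suc j" "\<beta> ^ skip k j" "(y (skip k j))\<^sup>2"]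
      by (simp add: f_def mult.assoc)
  qed
  ultimately have "(\<Sum>j. \<beta> * (\<beta> ^ j * (y (skip k j))\<^sup>2)) \<le> (\<Sum>j. f (skip k j))"
    using sm' by (intro suminf_le summable_mult) auto
  also have "\<dots> = suminf f"
    using suminf_mono_reindex[OF strict_mono_skip, of k f] zero by simp
  finally have "\<beta> * (\<Sum>j. \<beta> ^ j * (y (skip k j))\<^sup>2) \<le> suminf f"
    using sm' by (simp add: suminf_mult)
  from mult_left_mono[OF this, of "1 - \<beta>"] \<beta> show ?thesis
    unfolding V_def V_except_def f_def by (simp add: mult.left_commute)
qed

subsection \<open>Weighted sums of squares of i.i.d. variables\<close>

text \<open>The joint law is a product of copies of \<open>P\<close>. An injective reindexing
  selects distinct coordinates, so it maps this product measure to itself.\<close>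

lemma (in prob_space) nn_integral_iid_reindex:
  fixes Y :: "'i \<Rightarrow> 'a \<Rightarrow> 'b" and \<tau> :: "'i \<Rightarrow> 'i"
  assumes indep: "indep_vars (\<lambda>_. N) Y UNIV"
    and law: "\<And>k. distr M N (Y k) = P"
    and "inj \<tau>" and F: "F \<in> borel_measurable (PiM UNIV (\<lambda>_. N))"
  shows "(\<integral>\<^sup>+ \<omega>. F (\<lambda>k. Y (\<tau> k) \<omega>) \<partial>M) = (\<integral>\<^sup>+ \<omega>. F (\<lambda>k. Y k \<omega>) \<partial>M)"
proof -
  have rv [measurable]: "random_variable N (Y k)" for k
    using indep by (auto simp: indep_vars_def)
  have P: "prob_space P"
    using prob_space_distr[OF rv] law by metis
  have setsP: "sets P = sets N"
    using law by (metis sets_distr)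
  \<comment> \<open>\<open>P\<close> has the measurable sets of \<open>N\<close> but is another
    measure; this equality moves measurability between the two product spaces.\<close>
  have sets_PiM: "sets (PiM UNIV (\<lambda>_. P)) = sets (PiM UNIV (\<lambda>_. N))"
    by (intro sets_PiM_cong) (simp_all add: setsP)
  have seq: "(\<lambda>\<omega> k. Y k \<omega>) \<in> measurable M (PiM UNIV (\<lambda>_. N))"
    by (rule measurable_PiM_single') (auto dest: measurable_space[OF rv])
  have D: "distr M (PiM UNIV (\<lambda>_. N)) (\<lambda>\<omega> k. Y k \<omega>) = PiM UNIV (\<lambda>_. P)"
    using indep_vars_iff_distr_eq_PiM[where I = UNIV and M' = "\<lambda>_. N" and X = Y] indep rv law
    by (simp add: restrict_UNIV)
  have re: "(\<lambda>f k. f (\<tau> k)) \<in> measurable (PiM UNIV (\<lambda>_. N)) (PiM UNIV (\<lambda>_. N))"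
    by (rule measurable_PiM_single') (auto simp: space_PiM)
  have "(\<integral>\<^sup>+ \<omega>. F (\<lambda>k. Y (\<tau> k) \<omega>) \<partial>M) = (\<integral>\<^sup>+ f. F (\<lambda>k. f (\<tau> k)) \<partial>PiM UNIV (\<lambda>_. P))"
    unfolding D[symmetric] using measurable_compose[OF re F]
    by (subst nn_integral_distr[OF seq]) simp_all
  also have "\<dots> = (\<integral>\<^sup>+ f. F f \<partial>distr (PiM UNIV (\<lambda>_. P)) (PiM UNIV (\<lambda>_. P)) (\<lambda>f k. f (\<tau> k)))"
    using re F by (subst nn_integral_distr) (simp_all add: measurable_cong_sets[OF sets_PiM sets_PiM] measurable_cong_sets[OF sets_PiM refl] measurable_cong_sets[OF refl sets_PiM])
  also have "distr (PiM UNIV (\<lambda>_. P)) (PiM UNIV (\<lambda>_. P)) (\<lambda>f k. f (\<tau> k)) = PiM UNIV (\<lambda>_. P)"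
    using distr_PiM_reindex[of UNIV "\<lambda>_. P" \<tau> UNIV] P \<open>inj \<tau>\<close>
    by (simp add: restrict_UNIV)
  also have "(\<integral>\<^sup>+ f. F f \<partial>PiM UNIV (\<lambda>_. P)) = (\<integral>\<^sup>+ \<omega>. F (\<lambda>k. Y k \<omega>) \<partial>M)"
    unfolding D[symmetric] using F by (subst nn_integral_distr[OF seq]) simp_all
  finally show ?thesis .
qed

text \<open>Sum and integral may be exchanged for nonnegative terms, so the sum of the absolute
  values has finite integral and is therefore finite almost everywhere.\<close>

lemma AE_summable_norm:
  fixes f :: "nat \<Rightarrow> 'a \<Rightarrow> real"
  assumes int: "\<And>k. integrable M (f k)" and sm: "summable (\<lambda>k. \<integral>\<omega>. \<bar>f k \<omega>\<bar> \<partial>M)"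
  shows "AE \<omega> in M. summable (\<lambda>k. \<bar>f k \<omega>\<bar>)"
proof -
  have [measurable]: "f k \<in> borel_measurable M" for k
    using int by blast
  have "(\<integral>\<^sup>+ \<omega>. (\<Sum>k. ennreal \<bar>f k \<omega>\<bar>) \<partial>M) = (\<Sum>k. \<integral>\<^sup>+ \<omega>. ennreal \<bar>f k \<omega>\<bar> \<partial>M)"
    by (rule nn_integral_suminf) simp
  also have "\<dots> = (\<Sum>k. ennreal (\<integral>\<omega>. \<bar>f k \<omega>\<bar> \<partial>M))"
    by (intro arg_cong[where f = suminf] ext nn_integral_eq_integral integrable_abs int) simp
  also have "\<dots> \<noteq> \<infinity>"
    unfolding infinity_ennreal_def by (rule ennreal_suminf_neq_top[OF sm]) simp
  finally have "AE \<omega> in M. (\<Sum>k. ennreal \<bar>f k \<omega>\<bar>) \<noteq> \<infinity>"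
    by (intro nn_integral_PInf_AE) simp_all
  then show ?thesis
    by eventually_elim (auto intro!: summable_suminf_not_top)
qed

text \<open>Evaluates the integrand of \<open>in_L\<close> for an inverse square root. The case
  \<open>s = 0\<close> reflects \<open>1 / 0 = \<infinity>\<close> in \<open>ereal\<close> and is
  the source of the positivity of \<open>V\<close>.\<close>

lemma e2ennreal_inverse_power:
  assumes "0 \<le> s"
  shows "e2ennreal \<bar>1 / ereal s\<bar> ^ n = (if s = 0 then top ^ n else ennreal (1 / s ^ n))"
proof (cases "s = 0")
  case True
  then show ?thesis by (simp add: divide_ereal_def e2ennreal_infty)
next
  case False
  then have "1 / ereal s = ereal (1 / s)"
    using ereal_divide[of s 1] by (simp add: one_ereal_def)
  with False assms show ?thesis
    by (simp add: ennreal.abs_eq[symmetric] ennreal_power power_divide abs_of_nonneg)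
qed

text \<open>The setting obtained for fixed \<theta> and \<open>i\<close>: only one real component of
  the innovations remains. The weight \<alpha> is absent because it enters when the summands are
  added up.\<close>

locale iid_sequence = prob_space M for M :: "'a measure" +
  fixes Y :: "nat \<Rightarrow> 'a \<Rightarrow> real" and \<beta> \<epsilon> :: real
  assumes indep: "indep_vars (\<lambda>_. borel) Y UNIV"
    and law: "\<And>k. distr M borel (Y k) = distr M borel (Y 0)"
    and int5: "integrable M (\<lambda>\<omega>. \<bar>Y 0 \<omega>\<bar> ^ 5)"
    and \<beta>: "0 < \<beta>" "\<beta> < 1" and \<epsilon>: "0 < \<epsilon>"
    and V_in_L3: "in_L 3 M (\<lambda>\<omega>. 1 / ereal (sqrt (V \<beta> (\<lambda>k. Y k \<omega>))))"
begin

abbreviation "W \<omega> \<equiv> V \<beta> (\<lambda>k. Y k \<omega>)"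
abbreviation "D k \<omega> \<equiv> V_except \<beta> k (\<lambda>r. Y r \<omega>)"

section \<open>Measurability, moments and almost sure convergence\<close>

lemma measurable_Y [measurable]: "Y k \<in> borel_measurable M"
  using indep by (auto simp: indep_vars_def)

lemma measurable_W [measurable]: "W \<in> borel_measurable M"
  unfolding V_def by measurable

lemma measurable_D [measurable]: "D k \<in> borel_measurable M"
  unfolding V_except_def by measurable

lemma measurable_V: "V \<beta> \<in> borel_measurable (PiM UNIV (\<lambda>_. borel))"
  unfolding V_def[abs_def] by measurable

lemma
  fixes f :: "real \<Rightarrow> real"
  assumes [measurable]: "f \<in> borel_measurable borel"
  shows integrable_Y_iff: "integrable M (\<lambda>\<omega>. f (Y k \<omega>)) \<longleftrightarrow> integrable M (\<lambda>\<omega>. f (Y 0 \<omega>))"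
    and integral_Y_eq: "(\<integral>\<omega>. f (Y k \<omega>) \<partial>M) = (\<integral>\<omega>. f (Y 0 \<omega>) \<partial>M)"
proof -
  have "integrable M (\<lambda>\<omega>. f (Y j \<omega>)) \<longleftrightarrow> integrable (distr M borel (Y j)) f" for j
    by (rule integrable_distr_eq[symmetric]) simp_all
  from this[of k] this[of 0]
  show "integrable M (\<lambda>\<omega>. f (Y k \<omega>)) \<longleftrightarrow> integrable M (\<lambda>\<omega>. f (Y 0 \<omega>))"
    unfolding law[of k] by simp
  have "(\<integral>\<omega>. f (Y j \<omega>) \<partial>M) = integral\<^sup>L (distr M borel (Y j)) f" for j
    by (rule integral_distr[symmetric]) simp_all
  from this[of k] this[of 0]
  show "(\<integral>\<omega>. f (Y k \<omega>) \<partial>M) = (\<integral>\<omega>. f (Y 0 \<omega>) \<partial>M)"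
    unfolding law[of k] by simp
qed

lemma integrable_abs_power:
  assumes "n \<le> 5"
  shows "integrable M (\<lambda>\<omega>. \<bar>Y k \<omega>\<bar> ^ n)"
proof -
  have "\<bar>x\<bar> ^ n \<le> 1 + \<bar>x\<bar> ^ 5" for x :: real
  proof (cases "\<bar>x\<bar> \<le> 1")
    case True
    then have "\<bar>x\<bar> ^ n \<le> 1" by (intro power_le_one) auto
    then show ?thesis by (simp add: add_increasing2)
  next
    case False
    then have "\<bar>x\<bar> ^ n \<le> \<bar>x\<bar> ^ 5" using assms by (intro power_increasing) auto
    then show ?thesis by simp
  qed
  then have "integrable M (\<lambda>\<omega>. \<bar>Y 0 \<omega>\<bar> ^ n)"
    by (intro Bochner_Integration.integrable_bound[OF Bochner_Integration.integrable_add[OF integrable_const[of 1] int5]]) auto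
  then show ?thesis
    using integrable_Y_iff[of "\<lambda>x. \<bar>x\<bar> ^ n" k] by simp
qed

lemma integrable_power:
  assumes "n \<le> 5"
  shows "integrable M (\<lambda>\<omega>. Y k \<omega> ^ n)"
  using integrable_abs_power[OF assms, of k]
  by (rule Bochner_Integration.integrable_bound) (auto simp: power_abs)

text \<open>Whatever index \<open>\<tau> k\<close> is, the expected \<open>k\<close>-th term is
  \<open>c ^ k\<close> times one fixed moment, so the expectations form a geometric series. The free
  reindexing covers both the full sequence and the one along \<open>skip k\<close>.\<close>

lemma AE_summable_geometric:
  assumes c: "0 \<le> c" "c < 1" and "n \<le> 5"
  shows "AE \<omega> in M. summable (\<lambda>k. c ^ k * \<bar>Y (\<tau> k) \<omega>\<bar> ^ n)"
proof -
  have "AE \<omega> in M. summable (\<lambda>k. \<bar>c ^ k * \<bar>Y (\<tau> k) \<omega>\<bar> ^ n\<bar>)"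
  proof (rule AE_summable_norm)
    show "integrable M (\<lambda>\<omega>. c ^ k * \<bar>Y (\<tau> k) \<omega>\<bar> ^ n)" for k
      using integrable_abs_power[OF assms(3)] by simp
    have "(\<integral>\<omega>. \<bar>c ^ k * \<bar>Y (\<tau> k) \<omega>\<bar> ^ n\<bar> \<partial>M) = c ^ k * (\<integral>\<omega>. \<bar>Y 0 \<omega>\<bar> ^ n \<partial>M)" for k
      using integral_Y_eq[of "\<lambda>x. \<bar>x\<bar> ^ n" "\<tau> k"] c by (simp add: abs_mult)
    then show "summable (\<lambda>k. \<integral>\<omega>. \<bar>c ^ k * \<bar>Y (\<tau> k) \<omega>\<bar> ^ n\<bar> \<partial>M)"
      using c by (simp only:) (intro summable_mult2 summable_geometric, simp)
  qed
  then show ?thesis using c by (simp add: abs_mult)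
qed

lemma AE_summable_square: "AE \<omega> in M. summable (\<lambda>k. \<beta> ^ k * (Y (\<tau> k) \<omega>)\<^sup>2)"
  using AE_summable_geometric[of \<beta> 2 \<tau>] \<beta> by simp

text \<open>The integrand in \<open>V_in_L3\<close> has finite integral, hence is almost surely
  finite, which excludes \<open>W \<omega> = 0\<close>. Where \<open>W\<close> is positive it agrees
  with the real quotient.\<close>

lemma AE_V_pos: "AE \<omega> in M. 0 < W \<omega>"
  and integrable_V_inverse: "integrable M (\<lambda>\<omega>. 1 / sqrt (W \<omega>) ^ 3)"
proof -
  let ?g = "\<lambda>\<omega>. e2ennreal \<bar>1 / ereal (sqrt (W \<omega>))\<bar> ^ 3"
  have fin: "(\<integral>\<^sup>+ \<omega>. ?g \<omega> \<partial>M) < \<infinity>"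
    using V_in_L3 by (simp add: in_L_def)
  \<comment> \<open>Even the sign of \<open>W\<close> is known only almost surely, namely where its
    series converges.\<close>
  have nonneg: "AE \<omega> in M. 0 \<le> W \<omega>"
    using AE_summable_square[of "\<lambda>k. k"] by eventually_elim (use \<beta> in \<open>auto intro!: V_nonneg\<close>)
  have "AE \<omega> in M. ?g \<omega> \<noteq> \<infinity>"
    using fin by (intro nn_integral_PInf_AE) auto
  with nonneg show pos: "AE \<omega> in M. 0 < W \<omega>"
  proof eventually_elim
    case (elim \<omega>)
    show ?case
    proof (rule ccontr)
      assume "\<not> 0 < W \<omega>"
      with elim(1) have "sqrt (W \<omega>) = 0" by simp
      with elim(2) e2ennreal_inverse_power[of 0 3] show False
        by (simp add: top_power_ennreal)
    qed
  qed
  show "integrable M (\<lambda>\<omega>. 1 / sqrt (W \<omega>) ^ 3)"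
  proof (rule integrableI_nonneg)
    show "AE \<omega> in M. 0 \<le> 1 / sqrt (W \<omega>) ^ 3"
      using nonneg by eventually_elim auto
    have "AE \<omega> in M. ennreal (1 / sqrt (W \<omega>) ^ 3) = ?g \<omega>"
      using pos
    proof eventually_elim
      case (elim \<omega>)
      then show ?case using e2ennreal_inverse_power[of "sqrt (W \<omega>)" 3] by simp
    qed
    then have "(\<integral>\<^sup>+ \<omega>. ennreal (1 / sqrt (W \<omega>) ^ 3) \<partial>M) = (\<integral>\<^sup>+ \<omega>. ?g \<omega> \<partial>M)"
      by (rule nn_integral_cong_AE)
    then show "(\<integral>\<^sup>+ \<omega>. ennreal (1 / sqrt (W \<omega>) ^ 3) \<partial>M) < \<infinity>"
      using fin by simp
  qed simp
qed

text \<open>Invariance of the law, applied to the indicator of the exceptional set, shows that this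
  set stays null under the reindexing.\<close>

lemma AE_iid_reindex:
  assumes "inj \<tau>" and P: "Measurable.pred (PiM UNIV (\<lambda>_. borel)) P"
    and AE: "AE \<omega> in M. P (\<lambda>k. Y k \<omega>)"
  shows "AE \<omega> in M. P (\<lambda>k. Y (\<tau> k) \<omega>)"
proof -
  have [measurable]: "(\<lambda>\<omega> k. Y (\<tau> k) \<omega>) \<in> measurable M (PiM UNIV (\<lambda>_. borel))" for \<tau> :: "nat \<Rightarrow> nat"
    by (rule measurable_PiM_single') auto
  note measurable_compose[OF this P, measurable]
  let ?F = "\<lambda>x. if P x then 0 else 1 :: ennreal"
  have [measurable]: "?F \<in> borel_measurable (PiM UNIV (\<lambda>_. borel))"
    using P by measurable
  have "(\<integral>\<^sup>+ \<omega>. ?F (\<lambda>k. Y (\<tau> k) \<omega>) \<partial>M) = (\<integral>\<^sup>+ \<omega>. ?F (\<lambda>k. Y k \<omega>) \<partial>M)"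
    by (rule nn_integral_iid_reindex[OF indep law \<open>inj \<tau>\<close>]) simp
  also have "\<dots> = (\<integral>\<^sup>+ \<omega>. 0 \<partial>M)"
    by (rule nn_integral_cong_AE) (use AE in auto)
  also have "\<dots> = 0" by simp
  finally have "AE \<omega> in M. ?F (\<lambda>k. Y (\<tau> k) \<omega>) = 0"
    by (subst (asm) nn_integral_0_iff_AE) simp_all
  then show ?thesis by eventually_elim (auto split: if_splits)
qed

section \<open>Law and independence of the sum without its \<open>k\<close>-th term\<close>

lemma AE_V_skip_pos: "AE \<omega> in M. 0 < V \<beta> (\<lambda>j. Y (skip k j) \<omega>)"
proof (rule AE_iid_reindex[OF inj_skip, where P = "\<lambda>x. 0 < V \<beta> x"])
  show "Measurable.pred (PiM UNIV (\<lambda>_. borel)) (\<lambda>x. 0 < V \<beta> x)"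
    by (intro borel_measurable_pred_less borel_measurable_const measurable_V)
qed (rule AE_V_pos)

lemma AE_V_except_ge: "AE \<omega> in M. \<beta> * V \<beta> (\<lambda>j. Y (skip k j) \<omega>) \<le> D k \<omega>"
  using AE_summable_square[of "\<lambda>k. k"] AE_summable_square[of "skip k"]
proof eventually_elim
  case (elim \<omega>)
  with \<beta> show ?case using V_except_ge[of \<beta> "\<lambda>r. Y r \<omega>" k] by simp
qed

lemma AE_V_except_pos: "AE \<omega> in M. 0 < D k \<omega>"
  using AE_V_except_ge[of k] AE_V_skip_pos[of k]
proof eventually_elim
  case (elim \<omega>)
  from \<beta> elim(2) have "0 < \<beta> * V \<beta> (\<lambda>j. Y (skip k j) \<omega>)" by simp
  with elim(1) show ?case by linarith
qed

text \<open>\<open>D k\<close> is at least \<beta> times the \<open>V\<close> of the sequence along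
  \<open>skip k\<close>, and the latter has the law of \<open>W\<close>. So expectations of
  decreasing functions of \<open>D k\<close> are bounded uniformly in \<open>k\<close>.\<close>

lemma V_except_stochastic_dominance:
  fixes F :: "real \<Rightarrow> real"
  assumes F [measurable]: "F \<in> borel_measurable borel"
    and nonneg: "\<And>v. 0 < v \<Longrightarrow> 0 \<le> F v"
    and anti: "\<And>v w. 0 < v \<Longrightarrow> v \<le> w \<Longrightarrow> F w \<le> F v"
    and int: "integrable M (\<lambda>\<omega>. F (\<beta> * W \<omega>))"
  shows "integrable M (\<lambda>\<omega>. F (D k \<omega>))"
    and "(\<integral>\<omega>. F (D k \<omega>) \<partial>M) \<le> (\<integral>\<omega>. F (\<beta> * W \<omega>) \<partial>M)"
proof -
  have W_nonneg: "AE \<omega> in M. 0 \<le> F (\<beta> * W \<omega>)"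
    using AE_V_pos
  proof eventually_elim
    case (elim \<omega>)
    with \<beta> show ?case by (intro nonneg mult_pos_pos)
  qed
  have D_nonneg: "AE \<omega> in M. 0 \<le> F (D k \<omega>)"
    using AE_V_except_pos[of k] by eventually_elim (rule nonneg)
  have "AE \<omega> in M. ennreal (F (D k \<omega>)) \<le> ennreal (F (\<beta> * V \<beta> (\<lambda>j. Y (skip k j) \<omega>)))"
    using AE_V_except_ge[of k] AE_V_skip_pos[of k]
  proof eventually_elim
    case (elim \<omega>)
    with \<beta> show ?case by (intro ennreal_leI anti mult_pos_pos)
  qed
  then have "(\<integral>\<^sup>+ \<omega>. ennreal (F (D k \<omega>)) \<partial>M)
      \<le> (\<integral>\<^sup>+ \<omega>. ennreal (F (\<beta> * V \<beta> (\<lambda>j. Y (skip k j) \<omega>))) \<partial>M)"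
    by (rule nn_integral_mono_AE)
  \<comment> \<open>Passing from the gap-closed sequence to the original one changes the variables
    but not their joint law.\<close>
  also have "\<dots> = (\<integral>\<^sup>+ \<omega>. ennreal (F (\<beta> * W \<omega>)) \<partial>M)"
    using measurable_V
    by (intro nn_integral_iid_reindex[OF indep law inj_skip, where F = "\<lambda>x. ennreal (F (\<beta> * V \<beta> x))"]) simp
  also have "\<dots> = ennreal (\<integral>\<omega>. F (\<beta> * W \<omega>) \<partial>M)"
    using int W_nonneg by (rule nn_integral_eq_integral)
  finally have le: "(\<integral>\<^sup>+ \<omega>. ennreal (F (D k \<omega>)) \<partial>M) \<le> ennreal (\<integral>\<omega>. F (\<beta> * W \<omega>) \<partial>M)" .
  show int': "integrable M (\<lambda>\<omega>. F (D k \<omega>))"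
  proof (rule integrableI_nonneg)
    show "(\<integral>\<^sup>+ \<omega>. ennreal (F (D k \<omega>)) \<partial>M) < \<infinity>"
      using le by (rule le_less_trans) simp
  qed (use D_nonneg in simp_all)
  show "(\<integral>\<omega>. F (D k \<omega>) \<partial>M) \<le> (\<integral>\<omega>. F (\<beta> * W \<omega>) \<partial>M)"
    using le integral_nonneg_AE[OF W_nonneg]
    unfolding nn_integral_eq_integral[OF int' D_nonneg] by (simp add: ennreal_le_iff)
qed

text \<open>The two variables are functions of disjoint blocks of the independent family, the index
  \<open>k\<close> and its complement.\<close>

lemma indep_Y_V_except: "indep_var borel (Y k) borel (D k)"
proof -
  have "indep_var (PiM {k} (\<lambda>_. borel)) (\<lambda>\<omega>. restrict (\<lambda>r. Y r \<omega>) {k})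
      (PiM (- {k}) (\<lambda>_. borel)) (\<lambda>\<omega>. restrict (\<lambda>r. Y r \<omega>) (- {k}))"
    by (rule indep_var_restrict[OF indep]) auto
  moreover have "(\<lambda>x. x k) \<in> borel_measurable (PiM {k} (\<lambda>_. borel))"
    by measurable
  moreover have "V_except \<beta> k \<in> borel_measurable (PiM (- {k}) (\<lambda>_. borel))"
  proof -
    \<comment> \<open>The product over \<open>- {k}\<close> has no coordinate \<open>k\<close>; the
      term with that index is constant, so it is measurable all the same.\<close>
    have "(\<lambda>x. if r = k then 0 else \<beta> ^ r * (x r)\<^sup>2) \<in> borel_measurable (PiM (- {k}) (\<lambda>_. borel))" for r
      by (cases "r = k") simp_all
    then show ?thesis unfolding V_except_def[abs_def] by measurable
  qed
  ultimately have "indep_var borel ((\<lambda>x. x k) \<circ> (\<lambda>\<omega>. restrict (\<lambda>r. Y r \<omega>) {k}))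
      borel (V_except \<beta> k \<circ> (\<lambda>\<omega>. restrict (\<lambda>r. Y r \<omega>) (- {k})))"
    by (rule indep_var_compose)
  \<comment> \<open>Restriction puts \<open>undefined\<close> at index \<open>k\<close>, a value
    that \<open>V_except\<close> discards.\<close>
  moreover have "V_except \<beta> k (restrict (\<lambda>r. Y r \<omega>) (- {k})) = D k \<omega>" for \<omega>
    by (simp add: V_except_def cong: if_cong)
  ultimately show ?thesis by (simp add: comp_def)
qed

lemma
  fixes f F :: "real \<Rightarrow> real"
  assumes [measurable]: "f \<in> borel_measurable borel" "F \<in> borel_measurable borel"
    and int: "integrable M (\<lambda>\<omega>. f (Y k \<omega>))" "integrable M (\<lambda>\<omega>. F (D k \<omega>))"
  shows integrable_Y_V_except: "integrable M (\<lambda>\<omega>. f (Y k \<omega>) * F (D k \<omega>))"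
    and integral_Y_V_except:
      "(\<integral>\<omega>. f (Y k \<omega>) * F (D k \<omega>) \<partial>M) = (\<integral>\<omega>. f (Y k \<omega>) \<partial>M) * (\<integral>\<omega>. F (D k \<omega>) \<partial>M)"
proof -
  have "indep_var borel (\<lambda>\<omega>. f (Y k \<omega>)) borel (\<lambda>\<omega>. F (D k \<omega>))"
    using indep_var_compose[OF indep_Y_V_except assms(1,2)] by (simp add: comp_def)
  from indep_var_integrable[OF this int] indep_var_lebesgue_integral[OF this int]
  show "integrable M (\<lambda>\<omega>. f (Y k \<omega>) * F (D k \<omega>))"
    and "(\<integral>\<omega>. f (Y k \<omega>) * F (D k \<omega>) \<partial>M) = (\<integral>\<omega>. f (Y k \<omega>) \<partial>M) * (\<integral>\<omega>. F (D k \<omega>) \<partial>M)" .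
qed

subsection \<open>Expectations of the expanded summands\<close>

lemma integrable_gain_curv_V: "integrable M (\<lambda>\<omega>. gain_curv \<epsilon> (W \<omega>))"
proof (rule Bochner_Integration.integrable_bound)
  show "integrable M (\<lambda>\<omega>. 1 / \<epsilon>\<^sup>2 * (1 / sqrt (W \<omega>) ^ 3))"
    using integrable_V_inverse by (rule integrable_mult_right)
  show "AE \<omega> in M. norm (gain_curv \<epsilon> (W \<omega>)) \<le> norm (1 / \<epsilon>\<^sup>2 * (1 / sqrt (W \<omega>) ^ 3))"
    using AE_V_pos
  proof eventually_elim
    case (elim \<omega>)
    then show ?case
      using gain_curv_le[OF \<epsilon>, of "W \<omega>"] gain_curv_nonneg[of "W \<omega>" \<epsilon>] by simp
  qed
qed measurable

lemma AE_gain_curv_scale: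
  "AE \<omega> in M. gain_curv \<epsilon> (\<beta> * W \<omega>) \<le> 1 / sqrt \<beta> ^ 5 * gain_curv \<epsilon> (W \<omega>)"
  using AE_V_pos
proof eventually_elim
  case (elim \<omega>)
  with \<beta> \<epsilon> show ?case by (intro gain_curv_scale) auto
qed

lemma integrable_gain_curv_scaled: "integrable M (\<lambda>\<omega>. gain_curv \<epsilon> (\<beta> * W \<omega>))"
proof (rule Bochner_Integration.integrable_bound)
  show "integrable M (\<lambda>\<omega>. 1 / sqrt \<beta> ^ 5 * gain_curv \<epsilon> (W \<omega>))"
    using integrable_gain_curv_V by (rule integrable_mult_right)
  show "AE \<omega> in M. norm (gain_curv \<epsilon> (\<beta> * W \<omega>)) \<le> norm (1 / sqrt \<beta> ^ 5 * gain_curv \<epsilon> (W \<omega>))"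
    using AE_gain_curv_scale AE_V_pos
  proof eventually_elim
    case (elim \<omega>)
    then have "0 < \<beta> * W \<omega>" using \<beta> by simp
    from gain_curv_nonneg[OF this, of \<epsilon>] elim(1) show ?case
      unfolding real_norm_def by linarith
  qed
qed measurable

lemma integrable_gain_slope_scaled: "integrable M (\<lambda>\<omega>. gain_slope \<epsilon> (\<beta> * W \<omega>))"
proof (rule Bochner_Integration.integrable_bound)
  show "integrable M (\<lambda>\<omega>. 1 / \<epsilon>\<^sup>2 * (1 + 1 / sqrt \<beta> ^ 3 * (1 / sqrt (W \<omega>) ^ 3)))"
    by (intro integrable_mult_right Bochner_Integration.integrable_add integrable_const
        integrable_V_inverse)
  show "AE \<omega> in M. norm (gain_slope \<epsilon> (\<beta> * W \<omega>))
      \<le> norm (1 / \<epsilon>\<^sup>2 * (1 + 1 / sqrt \<beta> ^ 3 * (1 / sqrt (W \<omega>) ^ 3)))"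
    using AE_V_pos
  proof eventually_elim
    case (elim \<omega>)
    then have pos: "0 < \<beta> * W \<omega>" using \<beta> by simp
    have eq: "1 / sqrt (\<beta> * W \<omega>) ^ 3 = 1 / sqrt \<beta> ^ 3 * (1 / sqrt (W \<omega>) ^ 3)"
      by (simp add: real_sqrt_mult power_mult_distrib)
    show ?case
      using gain_slope_le[OF \<epsilon> pos] gain_slope_nonneg[OF pos, of \<epsilon>]
      unfolding eq real_norm_def by linarith
  qed
qed measurable

text \<open>Dominance compares \<open>D k\<close> with \<open>\<beta> * W\<close>, and scaling then
  removes \<beta> from the argument. This produces the power \<open>-5/2\<close> of \<beta> in the
  final constant.\<close>

lemma
  shows integrable_gain_curv_V_except: "integrable M (\<lambda>\<omega>. gain_curv \<epsilon> (D k \<omega>))"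
    and integral_gain_curv_V_except_le:
      "(\<integral>\<omega>. gain_curv \<epsilon> (D k \<omega>) \<partial>M) \<le> 1 / sqrt \<beta> ^ 5 * (\<integral>\<omega>. gain_curv \<epsilon> (W \<omega>) \<partial>M)"
proof -
  note dom = V_except_stochastic_dominance[OF measurable_gain(3)[of \<epsilon>] gain_curv_nonneg
      gain_curv_antimono[OF \<epsilon>] integrable_gain_curv_scaled, of k]
  show "integrable M (\<lambda>\<omega>. gain_curv \<epsilon> (D k \<omega>))" by (rule dom(1))
  have "(\<integral>\<omega>. gain_curv \<epsilon> (\<beta> * W \<omega>) \<partial>M) \<le> (\<integral>\<omega>. 1 / sqrt \<beta> ^ 5 * gain_curv \<epsilon> (W \<omega>) \<partial>M)"
    by (intro integral_mono_AE integrable_gain_curv_scaled integrable_mult_right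
        integrable_gain_curv_V AE_gain_curv_scale)
  with dom(2) show "(\<integral>\<omega>. gain_curv \<epsilon> (D k \<omega>) \<partial>M) \<le> 1 / sqrt \<beta> ^ 5 * (\<integral>\<omega>. gain_curv \<epsilon> (W \<omega>) \<partial>M)"
    by simp
qed

text \<open>The bound does not depend on \<open>k\<close>, which makes the second series of the
  approximation converge.\<close>

lemma
  shows integrable_gain_slope_V_except: "integrable M (\<lambda>\<omega>. gain_slope \<epsilon> (D k \<omega>))"
    and integral_gain_slope_V_except_le:
      "(\<integral>\<omega>. gain_slope \<epsilon> (D k \<omega>) \<partial>M) \<le> (\<integral>\<omega>. gain_slope \<epsilon> (\<beta> * W \<omega>) \<partial>M)"
  using V_except_stochastic_dominance[OF measurable_gain(2)[of \<epsilon>] gain_slope_nonneg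
      gain_slope_antimono[OF \<epsilon>] integrable_gain_slope_scaled, of k] by blast+

lemma integral_gain_slope_V_except_nonneg: "0 \<le> (\<integral>\<omega>. gain_slope \<epsilon> (D k \<omega>) \<partial>M)"
  using AE_V_except_pos[of k]
  by (intro integral_nonneg_AE, eventually_elim) (rule gain_slope_nonneg)

lemma
  shows integrable_gain_V_except: "integrable M (\<lambda>\<omega>. gain \<epsilon> (D k \<omega>))"
    and integral_gain_V_except_bounds:
      "0 \<le> (\<integral>\<omega>. gain \<epsilon> (D k \<omega>) \<partial>M)" "(\<integral>\<omega>. gain \<epsilon> (D k \<omega>) \<partial>M) \<le> 1 / \<epsilon>"
proof -
  have b: "AE \<omega> in M. 0 \<le> gain \<epsilon> (D k \<omega>) \<and> gain \<epsilon> (D k \<omega>) \<le> 1 / \<epsilon>"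
    using AE_V_except_pos[of k]
  proof eventually_elim
    case (elim \<omega>)
    then show ?case using gain_bounds[OF \<epsilon>, of "D k \<omega>"] by simp
  qed
  then have "AE \<omega> in M. norm (gain \<epsilon> (D k \<omega>)) \<le> 1 / \<epsilon>"
    by eventually_elim simp
  then show int: "integrable M (\<lambda>\<omega>. gain \<epsilon> (D k \<omega>))"
    by (intro integrable_const_bound[where B = "1 / \<epsilon>"]) simp_all
  from b have "AE \<omega> in M. 0 \<le> gain \<epsilon> (D k \<omega>)"
    by eventually_elim simp
  then show "0 \<le> (\<integral>\<omega>. gain \<epsilon> (D k \<omega>) \<partial>M)"
    by (rule integral_nonneg_AE)
  from b have "AE \<omega> in M. gain \<epsilon> (D k \<omega>) \<le> 1 / \<epsilon>"
    by eventually_elim simp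
  from integral_mono_AE[OF int integrable_const this]
  show "(\<integral>\<omega>. gain \<epsilon> (D k \<omega>) \<partial>M) \<le> 1 / \<epsilon>"
    by (simp add: prob_space)
qed

section \<open>The summands of the Adam field and their expansion\<close>

lemma AE_Y_gain_V_le: "AE \<omega> in M. \<bar>Y k \<omega> * gain \<epsilon> (W \<omega>)\<bar> \<le> 1 / \<epsilon> * \<bar>Y k \<omega>\<bar>"
  using AE_V_pos
proof eventually_elim
  case (elim \<omega>)
  then have "\<bar>gain \<epsilon> (W \<omega>)\<bar> \<le> 1 / \<epsilon>" using gain_bounds[OF \<epsilon>, of "W \<omega>"] by simp
  then have "\<bar>gain \<epsilon> (W \<omega>)\<bar> * \<bar>Y k \<omega>\<bar> \<le> 1 / \<epsilon> * \<bar>Y k \<omega>\<bar>"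
    by (rule mult_right_mono) simp
  then show ?case by (simp add: abs_mult mult.commute)
qed

lemma integrable_abs_Y: "integrable M (\<lambda>\<omega>. \<bar>Y k \<omega>\<bar>)"
  using integrable_abs_power[of 1 k] by simp

lemma integrable_Y_gain_V: "integrable M (\<lambda>\<omega>. Y k \<omega> * gain \<epsilon> (W \<omega>))"
proof (rule Bochner_Integration.integrable_bound)
  show "integrable M (\<lambda>\<omega>. 1 / \<epsilon> * \<bar>Y k \<omega>\<bar>)"
    by (intro integrable_mult_right integrable_abs_Y)
  show "AE \<omega> in M. norm (Y k \<omega> * gain \<epsilon> (W \<omega>)) \<le> norm (1 / \<epsilon> * \<bar>Y k \<omega>\<bar>)"
    using AE_Y_gain_V_le[of k] by eventually_elim (use \<epsilon> in simp)
qed measurable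

lemma integral_abs_Y_gain_V_le: "(\<integral>\<omega>. \<bar>Y k \<omega> * gain \<epsilon> (W \<omega>)\<bar> \<partial>M) \<le> 1 / \<epsilon> * (\<integral>\<omega>. \<bar>Y 0 \<omega>\<bar> \<partial>M)"
proof -
  have "(\<integral>\<omega>. \<bar>Y k \<omega> * gain \<epsilon> (W \<omega>)\<bar> \<partial>M) \<le> (\<integral>\<omega>. 1 / \<epsilon> * \<bar>Y k \<omega>\<bar> \<partial>M)"
    by (intro integral_mono_AE integrable_abs integrable_Y_gain_V integrable_mult_right
        integrable_abs_Y AE_Y_gain_V_le)
  also have "\<dots> = 1 / \<epsilon> * (\<integral>\<omega>. \<bar>Y k \<omega>\<bar> \<partial>M)" by simp
  also have "(\<integral>\<omega>. \<bar>Y k \<omega>\<bar> \<partial>M) = (\<integral>\<omega>. \<bar>Y 0 \<omega>\<bar> \<partial>M)"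
    by (rule integral_Y_eq) simp
  finally show ?thesis .
qed

text \<open>Multiplying the expansion of \<open>gain \<epsilon>\<close> at \<open>D k\<close>, with
  increment a multiple of the square of \<open>Y k\<close>, by \<open>Y k\<close> itself gives the
  powers 1, 3 and 5 of \<open>Y k\<close>. Each is independent of its coefficient, a function of
  \<open>D k\<close>.\<close>

lemma expectation_Y_gain_V:
  "\<bar>(\<integral>\<omega>. Y k \<omega> * gain \<epsilon> (W \<omega>) \<partial>M)
     - ((\<integral>\<omega>. gain \<epsilon> (D k \<omega>) \<partial>M) * (\<integral>\<omega>. Y 0 \<omega> \<partial>M)
        - (1 - \<beta>) * \<beta> ^ k * ((\<integral>\<omega>. gain_slope \<epsilon> (D k \<omega>) \<partial>M) * (\<integral>\<omega>. Y 0 \<omega> ^ 3 \<partial>M)))\<bar>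
   \<le> (\<beta>\<^sup>2) ^ k * (3 / 8 * (1 - \<beta>)\<^sup>2 *
       ((1 / sqrt \<beta> ^ 5 * (\<integral>\<omega>. gain_curv \<epsilon> (W \<omega>) \<partial>M)) * (\<integral>\<omega>. \<bar>Y 0 \<omega>\<bar> ^ 5 \<partial>M)))"
proof -
  define c where "c = (1 - \<beta>) * \<beta> ^ k"
  have c: "0 \<le> c" using \<beta> by (simp add: c_def)
  define T where "T \<omega> = Y k \<omega> * gain \<epsilon> (W \<omega>)
      - (Y k \<omega> * gain \<epsilon> (D k \<omega>) - c * (Y k \<omega> ^ 3 * gain_slope \<epsilon> (D k \<omega>)))" for \<omega>
  \<comment> \<open>In each of the three terms independence factors the expectation, and equality of
    laws replaces \<open>Y k\<close> by \<open>Y 0\<close>.\<close>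
  have int1: "integrable M (\<lambda>\<omega>. Y k \<omega> * gain \<epsilon> (D k \<omega>))"
    and eq1: "(\<integral>\<omega>. Y k \<omega> * gain \<epsilon> (D k \<omega>) \<partial>M) = (\<integral>\<omega>. gain \<epsilon> (D k \<omega>) \<partial>M) * (\<integral>\<omega>. Y 0 \<omega> \<partial>M)"
    using integrable_Y_V_except[of "\<lambda>x. x" "gain \<epsilon>" k] integral_Y_V_except[of "\<lambda>x. x" "gain \<epsilon>" k]
      integrable_gain_V_except[of k] integrable_power[of 1 k] integral_Y_eq[of "\<lambda>x. x" k]
    by (simp_all add: mult.commute)
  have int2: "integrable M (\<lambda>\<omega>. Y k \<omega> ^ 3 * gain_slope \<epsilon> (D k \<omega>))"
    and eq2: "(\<integral>\<omega>. Y k \<omega> ^ 3 * gain_slope \<epsilon> (D k \<omega>) \<partial>M)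
      = (\<integral>\<omega>. gain_slope \<epsilon> (D k \<omega>) \<partial>M) * (\<integral>\<omega>. Y 0 \<omega> ^ 3 \<partial>M)"
    using integrable_Y_V_except[of "\<lambda>x. x ^ 3" "gain_slope \<epsilon>" k]
      integral_Y_V_except[of "\<lambda>x. x ^ 3" "gain_slope \<epsilon>" k]
      integrable_gain_slope_V_except[of k] integrable_power[of 3 k] integral_Y_eq[of "\<lambda>x. x ^ 3" k]
    by (simp_all add: mult.commute)
  have int3: "integrable M (\<lambda>\<omega>. \<bar>Y k \<omega>\<bar> ^ 5 * gain_curv \<epsilon> (D k \<omega>))"
    and eq3: "(\<integral>\<omega>. \<bar>Y k \<omega>\<bar> ^ 5 * gain_curv \<epsilon> (D k \<omega>) \<partial>M)
      = (\<integral>\<omega>. gain_curv \<epsilon> (D k \<omega>) \<partial>M) * (\<integral>\<omega>. \<bar>Y 0 \<omega>\<bar> ^ 5 \<partial>M)"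
    using integrable_Y_V_except[of "\<lambda>x. \<bar>x\<bar> ^ 5" "gain_curv \<epsilon>" k]
      integral_Y_V_except[of "\<lambda>x. \<bar>x\<bar> ^ 5" "gain_curv \<epsilon>" k]
      integrable_gain_curv_V_except[of k] integrable_abs_power[of 5 k]
      integral_Y_eq[of "\<lambda>x. \<bar>x\<bar> ^ 5" k]
    by (simp_all add: mult.commute)
  have intT: "integrable M T"
    unfolding T_def
    by (intro Bochner_Integration.integrable_diff integrable_Y_gain_V int1 integrable_mult_right int2)
  have eqT: "(\<integral>\<omega>. T \<omega> \<partial>M) = (\<integral>\<omega>. Y k \<omega> * gain \<epsilon> (W \<omega>) \<partial>M)
     - ((\<integral>\<omega>. gain \<epsilon> (D k \<omega>) \<partial>M) * (\<integral>\<omega>. Y 0 \<omega> \<partial>M)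
        - c * ((\<integral>\<omega>. gain_slope \<epsilon> (D k \<omega>) \<partial>M) * (\<integral>\<omega>. Y 0 \<omega> ^ 3 \<partial>M)))"
    unfolding T_def eq1[symmetric] eq2[symmetric]
    using integrable_Y_gain_V[of k] int1 int2 by simp
  have T_le: "AE \<omega> in M. \<bar>T \<omega>\<bar> \<le> 3 / 8 * c\<^sup>2 * (\<bar>Y k \<omega>\<bar> ^ 5 * gain_curv \<epsilon> (D k \<omega>))"
    using AE_summable_square[of "\<lambda>k. k"] AE_V_except_pos[of k]
  proof eventually_elim
    case (elim \<omega>)
    have W: "W \<omega> = D k \<omega> + c * (Y k \<omega>)\<^sup>2"
      using V_eq_V_except[OF elim(1), of k] by (simp add: c_def mult.assoc)
    have "T \<omega> = Y k \<omega> * (gain \<epsilon> (D k \<omega> + c * (Y k \<omega>)\<^sup>2) - gain \<epsilon> (D k \<omega>)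
        + c * (Y k \<omega>)\<^sup>2 * gain_slope \<epsilon> (D k \<omega>))"
      unfolding T_def W by (simp add: algebra_simps power2_eq_square power3_eq_cube)
    then have "\<bar>T \<omega>\<bar> = \<bar>Y k \<omega>\<bar> * \<bar>gain \<epsilon> (D k \<omega> + c * (Y k \<omega>)\<^sup>2) - gain \<epsilon> (D k \<omega>)
        + c * (Y k \<omega>)\<^sup>2 * gain_slope \<epsilon> (D k \<omega>)\<bar>"
      by (simp only: abs_mult)
    also have "\<dots> \<le> \<bar>Y k \<omega>\<bar> * (3 / 8 * (c * (Y k \<omega>)\<^sup>2)\<^sup>2 * gain_curv \<epsilon> (D k \<omega>))"
      using c \<epsilon> elim(2) by (intro mult_left_mono gain_taylor) auto
    \<comment> \<open>The even power equals that of the absolute value and so combines with the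
      outer factor to a fifth power.\<close>
    also have "(c * (Y k \<omega>)\<^sup>2)\<^sup>2 = c\<^sup>2 * \<bar>Y k \<omega>\<bar> ^ 4"
      by (simp add: power_mult_distrib)
    also have "\<bar>Y k \<omega>\<bar> * (3 / 8 * (c\<^sup>2 * \<bar>Y k \<omega>\<bar> ^ 4) * gain_curv \<epsilon> (D k \<omega>))
        = 3 / 8 * c\<^sup>2 * (\<bar>Y k \<omega>\<bar> ^ 5 * gain_curv \<epsilon> (D k \<omega>))"
      by (simp add: eval_nat_numeral mult_ac)
    finally show ?case .
  qed
  have "\<bar>\<integral>\<omega>. T \<omega> \<partial>M\<bar> \<le> (\<integral>\<omega>. \<bar>T \<omega>\<bar> \<partial>M)"
    by (rule integral_abs_bound)
  also have "\<dots> \<le> (\<integral>\<omega>. 3 / 8 * c\<^sup>2 * (\<bar>Y k \<omega>\<bar> ^ 5 * gain_curv \<epsilon> (D k \<omega>)) \<partial>M)"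
    by (intro integral_mono_AE integrable_abs intT integrable_mult_right int3 T_le)
  also have "\<dots> = 3 / 8 * c\<^sup>2 * ((\<integral>\<omega>. gain_curv \<epsilon> (D k \<omega>) \<partial>M) * (\<integral>\<omega>. \<bar>Y 0 \<omega>\<bar> ^ 5 \<partial>M))"
    unfolding eq3[symmetric] by simp
  also have "\<dots> \<le> 3 / 8 * c\<^sup>2 * ((1 / sqrt \<beta> ^ 5 * (\<integral>\<omega>. gain_curv \<epsilon> (W \<omega>) \<partial>M)) * (\<integral>\<omega>. \<bar>Y 0 \<omega>\<bar> ^ 5 \<partial>M))"
    by (intro mult_left_mono mult_right_mono integral_gain_curv_V_except_le) auto
  \<comment> \<open>The quadratic remainder squares the weight of the \<open>k\<close>-th term,
    whence the ratio \<open>\<beta>\<^sup>2\<close>.\<close>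
  also have "c\<^sup>2 = (\<beta>\<^sup>2) ^ k * (1 - \<beta>)\<^sup>2"
    by (simp add: c_def power_mult_distrib power_mult[symmetric] mult.commute)
  finally show ?thesis
    unfolding eqT by (simp add: c_def mult_ac)
qed

section \<open>Summation over \<open>k\<close>\<close>

lemma integral_gain_momentum_sums:
  assumes \<alpha>: "0 \<le> \<alpha>" "\<alpha> < 1"
  shows "(\<lambda>k. \<alpha> ^ k * (\<integral>\<omega>. Y k \<omega> * gain \<epsilon> (W \<omega>) \<partial>M)) sums
    (\<integral>\<omega>. gain \<epsilon> (W \<omega>) * (\<Sum>k. \<alpha> ^ k * Y k \<omega>) \<partial>M)"
proof -
  define f where "f k \<omega> = \<alpha> ^ k * (Y k \<omega> * gain \<epsilon> (W \<omega>))" for k \<omega>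
  have int: "integrable M (f k)" for k
    unfolding f_def by (intro integrable_mult_right integrable_Y_gain_V)
  have abs: "\<bar>f k \<omega>\<bar> = \<alpha> ^ k * \<bar>Y k \<omega> * gain \<epsilon> (W \<omega>)\<bar>" for k \<omega>
    using \<alpha> by (simp add: f_def abs_mult)
  \<comment> \<open>The bound on the expected absolute terms is geometric in \<alpha>; this absolute
    convergence permits the exchange of sum and expectation.\<close>
  have sm: "summable (\<lambda>k. \<integral>\<omega>. \<bar>f k \<omega>\<bar> \<partial>M)"
  proof (rule summable_comparison_test')
    show "summable (\<lambda>k. \<alpha> ^ k * (1 / \<epsilon> * (\<integral>\<omega>. \<bar>Y 0 \<omega>\<bar> \<partial>M)))"
      using \<alpha> by (intro summable_mult2 summable_geometric) simp
    show "norm (\<integral>\<omega>. \<bar>f k \<omega>\<bar> \<partial>M) \<le> \<alpha> ^ k * (1 / \<epsilon> * (\<integral>\<omega>. \<bar>Y 0 \<omega>\<bar> \<partial>M))" if "0 \<le> k" for k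
      unfolding abs using \<alpha> mult_left_mono[OF integral_abs_Y_gain_V_le, of "\<alpha> ^ k" k]
      by (simp add: abs_of_nonneg)
  qed
  have sums: "(\<lambda>k. integral\<^sup>L M (f k)) sums (\<integral>\<omega>. (\<Sum>k. f k \<omega>) \<partial>M)"
    using AE_summable_norm[OF int sm] sm by (intro sums_integral int) simp_all
  \<comment> \<open>The common factor leaves the sum where the momentum series converges, hence
    almost surely.\<close>
  have "AE \<omega> in M. (\<Sum>k. f k \<omega>) = gain \<epsilon> (W \<omega>) * (\<Sum>k. \<alpha> ^ k * Y k \<omega>)"
    using AE_summable_geometric[OF \<alpha>, where n = 1 and \<tau> = "\<lambda>k. k", simplified]
  proof eventually_elim
    case (elim \<omega>)
    have "summable (\<lambda>k. \<alpha> ^ k * Y k \<omega>)"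
      by (rule summable_rabs_cancel) (use elim \<alpha> in \<open>simp add: abs_mult\<close>)
    from suminf_mult[OF this, of "gain \<epsilon> (W \<omega>)"] show ?case
      by (simp add: f_def mult_ac)
  qed
  then have "(\<integral>\<omega>. (\<Sum>k. f k \<omega>) \<partial>M) = (\<integral>\<omega>. gain \<epsilon> (W \<omega>) * (\<Sum>k. \<alpha> ^ k * Y k \<omega>) \<partial>M)"
    by (intro integral_cong_AE) (simp_all add: f_def)
  with sums show ?thesis by (simp add: f_def[abs_def])
qed

text \<open>The errors of the single summands, weighted by \<open>\<alpha> ^ k\<close>, are bounded
  by a geometric series of ratio \<open>\<alpha> * \<beta>\<^sup>2\<close>, which explains the first
  factor of the bound.\<close>

lemma first_order_approx_error:
  assumes \<alpha>: "0 \<le> \<alpha>" "\<alpha> < 1"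
  shows "\<bar>(\<integral>\<omega>. gain \<epsilon> (W \<omega>) * (\<Sum>k. \<alpha> ^ k * Y k \<omega>) \<partial>M)
      - ((\<Sum>k. \<alpha> ^ k * (\<integral>\<omega>. gain \<epsilon> (D k \<omega>) \<partial>M) * (\<integral>\<omega>. Y 0 \<omega> \<partial>M))
         - (1 - \<beta>) * (\<Sum>k. (\<alpha> * \<beta>) ^ k * (\<integral>\<omega>. gain_slope \<epsilon> (D k \<omega>) \<partial>M) * (\<integral>\<omega>. Y 0 \<omega> ^ 3 \<partial>M)))\<bar>
    \<le> 1 / (1 - \<alpha> * \<beta>\<^sup>2) * (3 / 8 * (1 - \<beta>)\<^sup>2 *
       ((1 / sqrt \<beta> ^ 5 * (\<integral>\<omega>. gain_curv \<epsilon> (W \<omega>) \<partial>M)) * (\<integral>\<omega>. \<bar>Y 0 \<omega>\<bar> ^ 5 \<partial>M)))"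
proof -
  define m1 where "m1 = (\<integral>\<omega>. Y 0 \<omega> \<partial>M)"
  define m3 where "m3 = (\<integral>\<omega>. Y 0 \<omega> ^ 3 \<partial>M)"
  define p where "p k = (\<integral>\<omega>. gain \<epsilon> (D k \<omega>) \<partial>M)" for k
  define q where "q k = (\<integral>\<omega>. gain_slope \<epsilon> (D k \<omega>) \<partial>M)" for k
  define e where "e k = (\<integral>\<omega>. Y k \<omega> * gain \<epsilon> (W \<omega>) \<partial>M)" for k
  define C where "C = 3 / 8 * (1 - \<beta>)\<^sup>2 *
       ((1 / sqrt \<beta> ^ 5 * (\<integral>\<omega>. gain_curv \<epsilon> (W \<omega>) \<partial>M)) * (\<integral>\<omega>. \<bar>Y 0 \<omega>\<bar> ^ 5 \<partial>M))"
  define t where "t k = e k - (p k * m1 - (1 - \<beta>) * \<beta> ^ k * (q k * m3))" for k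
  have t: "\<bar>t k\<bar> \<le> (\<beta>\<^sup>2) ^ k * C" for k
    unfolding t_def e_def p_def q_def m1_def m3_def C_def by (rule expectation_Y_gain_V)
  have \<alpha>\<beta>: "0 \<le> \<alpha> * \<beta>" "\<alpha> * \<beta> < 1" "0 \<le> \<alpha> * \<beta>\<^sup>2" "\<alpha> * \<beta>\<^sup>2 < 1"
  proof -
    have "\<beta>\<^sup>2 \<le> 1" using \<beta> by (simp add: power_le_one)
    then show "\<alpha> * \<beta>\<^sup>2 < 1" using \<alpha> mult_left_le[of "\<beta>\<^sup>2" \<alpha>] by linarith
    show "\<alpha> * \<beta> < 1" using \<alpha> \<beta> mult_left_le[of \<beta> \<alpha>] by linarith
  qed (use \<alpha> \<beta> in auto)
  \<comment> \<open>Both series of the approximation have to converge separately before they can be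
    merged termwise with that of the Adam field.\<close>
  have "summable (\<lambda>k. \<alpha> ^ k * p k)"
  proof (rule summable_comparison_test')
    show "summable (\<lambda>k. \<alpha> ^ k * (1 / \<epsilon>))"
      using \<alpha> by (intro summable_mult2 summable_geometric) simp
    show "norm (\<alpha> ^ k * p k) \<le> \<alpha> ^ k * (1 / \<epsilon>)" if "0 \<le> k" for k
      using \<alpha> integral_gain_V_except_bounds[of k] mult_left_mono[of "p k" "1 / \<epsilon>" "\<alpha> ^ k"]
      by (simp add: p_def abs_mult)
  qed
  then have sm1: "summable (\<lambda>k. \<alpha> ^ k * p k * m1)"
    by (rule summable_mult2)
  have "summable (\<lambda>k. (\<alpha> * \<beta>) ^ k * q k)"
  proof (rule summable_comparison_test')
    let ?Q = "\<integral>\<omega>. gain_slope \<epsilon> (\<beta> * W \<omega>) \<partial>M"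
    show "summable (\<lambda>k. (\<alpha> * \<beta>) ^ k * ?Q)"
      using \<alpha>\<beta> by (intro summable_mult2 summable_geometric) simp
    show "norm ((\<alpha> * \<beta>) ^ k * q k) \<le> (\<alpha> * \<beta>) ^ k * ?Q" if "0 \<le> k" for k
    proof -
      have "\<bar>q k\<bar> \<le> ?Q"
        using integral_gain_slope_V_except_nonneg[of k] integral_gain_slope_V_except_le[of k]
        by (simp add: q_def)
      then have "(\<alpha> * \<beta>) ^ k * \<bar>q k\<bar> \<le> (\<alpha> * \<beta>) ^ k * ?Q"
        using \<alpha>\<beta>(1) by (intro mult_left_mono) auto
      then show ?thesis
        using \<alpha>\<beta>(1) by (simp only: real_norm_def abs_mult abs_of_nonneg zero_le_power)
    qed
  qed
  then have sm2: "summable (\<lambda>k. (\<alpha> * \<beta>) ^ k * q k * m3)"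
    by (rule summable_mult2)
  have sums_e: "(\<lambda>k. \<alpha> ^ k * e k) sums (\<integral>\<omega>. gain \<epsilon> (W \<omega>) * (\<Sum>k. \<alpha> ^ k * Y k \<omega>) \<partial>M)"
    unfolding e_def by (rule integral_gain_momentum_sums[OF \<alpha>])
  have t_eq: "\<alpha> ^ k * t k
      = \<alpha> ^ k * e k - (\<alpha> ^ k * p k * m1 - (1 - \<beta>) * ((\<alpha> * \<beta>) ^ k * q k * m3))" for k
    by (simp add: t_def algebra_simps power_mult_distrib)
  have "(\<lambda>k. \<alpha> ^ k * t k) sums
      ((\<integral>\<omega>. gain \<epsilon> (W \<omega>) * (\<Sum>k. \<alpha> ^ k * Y k \<omega>) \<partial>M)
       - ((\<Sum>k. \<alpha> ^ k * p k * m1) - (1 - \<beta>) * (\<Sum>k. (\<alpha> * \<beta>) ^ k * q k * m3)))"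
    unfolding t_eq by (intro sums_diff sums_e sums_mult summable_sums sm1 sm2)
  then have sums_t: "\<bar>(\<integral>\<omega>. gain \<epsilon> (W \<omega>) * (\<Sum>k. \<alpha> ^ k * Y k \<omega>) \<partial>M)
       - ((\<Sum>k. \<alpha> ^ k * p k * m1) - (1 - \<beta>) * (\<Sum>k. (\<alpha> * \<beta>) ^ k * q k * m3))\<bar> = \<bar>\<Sum>k. \<alpha> ^ k * t k\<bar>"
    by (simp add: sums_iff)
  have bound: "\<bar>\<alpha> ^ k * t k\<bar> \<le> (\<alpha> * \<beta>\<^sup>2) ^ k * C" for k
    using \<alpha> mult_left_mono[OF t[of k], of "\<alpha> ^ k"] by (simp add: abs_mult power_mult_distrib mult.assoc)
  have "(\<lambda>k. (\<alpha> * \<beta>\<^sup>2) ^ k * C) sums (1 / (1 - \<alpha> * \<beta>\<^sup>2) * C)"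
    using \<alpha>\<beta> by (intro sums_mult2 geometric_sums) (simp only: real_norm_def abs_of_nonneg)
  then have geo: "summable (\<lambda>k. (\<alpha> * \<beta>\<^sup>2) ^ k * C)"
      "(\<Sum>k. (\<alpha> * \<beta>\<^sup>2) ^ k * C) = 1 / (1 - \<alpha> * \<beta>\<^sup>2) * C"
    unfolding sums_iff by blast+
  have "\<bar>\<Sum>k. \<alpha> ^ k * t k\<bar> \<le> (\<Sum>k. (\<alpha> * \<beta>\<^sup>2) ^ k * C)"
    using norm_suminf_le[of "\<lambda>k. \<alpha> ^ k * t k", OF _ geo(1)] bound by simp
  then show ?thesis
    unfolding geo(2) sums_t[symmetric] unfolding p_def q_def m1_def m3_def C_def .
qed

section \<open>Agreement with the expectations in the statement\<close>

lemma second_expectation_gain_slope: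
  "(\<integral>\<^sup>+ \<omega>. ennreal (1 / (sqrt (D k \<omega>) + \<epsilon>)\<^sup>2) * (1 / ennreal (2 * sqrt (D k \<omega>))) \<partial>M)
    = ennreal (\<integral>\<omega>. gain_slope \<epsilon> (D k \<omega>) \<partial>M)"
proof -
  \<comment> \<open>Where \<open>D k\<close> is positive, division in \<open>ennreal\<close> is
    division of reals; the value \<open>\<infinity>\<close> at zero is confined to a null
    set.\<close>
  have "AE \<omega> in M. ennreal (1 / (sqrt (D k \<omega>) + \<epsilon>)\<^sup>2) * (1 / ennreal (2 * sqrt (D k \<omega>)))
      = ennreal (gain_slope \<epsilon> (D k \<omega>))"
    using AE_V_except_pos[of k]
  proof eventually_elim
    case (elim \<omega>)
    then have "1 / ennreal (2 * sqrt (D k \<omega>)) = ennreal (1 / (2 * sqrt (D k \<omega>)))"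
      using divide_ennreal[of 1 "2 * sqrt (D k \<omega>)"] by simp
    with elim show ?case
      by (simp add: gain_slope_def ennreal_mult[symmetric])
  qed
  then have "(\<integral>\<^sup>+ \<omega>. ennreal (1 / (sqrt (D k \<omega>) + \<epsilon>)\<^sup>2) * (1 / ennreal (2 * sqrt (D k \<omega>))) \<partial>M)
      = (\<integral>\<^sup>+ \<omega>. ennreal (gain_slope \<epsilon> (D k \<omega>)) \<partial>M)"
    by (rule nn_integral_cong_AE)
  also have "\<dots> = ennreal (\<integral>\<omega>. gain_slope \<epsilon> (D k \<omega>) \<partial>M)"
  proof (rule nn_integral_eq_integral[OF integrable_gain_slope_V_except])
    show "AE \<omega> in M. 0 \<le> gain_slope \<epsilon> (D k \<omega>)"
      using AE_V_except_pos[of k] by eventually_elim (rule gain_slope_nonneg)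
  qed
  finally show ?thesis .
qed

lemma integral_gain_curv_powr:
  "(\<integral>\<omega>. 1 / ((sqrt (W \<omega>) + \<epsilon>)\<^sup>2 * W \<omega> powr (3 / 2)) \<partial>M) = (\<integral>\<omega>. gain_curv \<epsilon> (W \<omega>) \<partial>M)"
proof (rule integral_cong_AE)
  show "AE \<omega> in M. 1 / ((sqrt (W \<omega>) + \<epsilon>)\<^sup>2 * W \<omega> powr (3 / 2)) = gain_curv \<epsilon> (W \<omega>)"
    using AE_V_pos
  proof eventually_elim
    case (elim \<omega>)
    then have "W \<omega> powr (3 / 2) = sqrt (W \<omega>) ^ 3"
      by (simp add: powr_half_sqrt[symmetric] powr_power)
    then show ?case by (simp add: gain_curv_def)
  qed
qed measurable

end

theorem theorem8p1:
  fixes N :: "'w measure" and \<U> :: "'u measure" and M :: "'a measure"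
    and X :: "'u \<times> (real ^ 'd) \<Rightarrow> (real ^ 'd)" and U :: "'w \<Rightarrow> 'u"
    and Us :: "nat \<Rightarrow> 'a \<Rightarrow> 'u"
    and \<alpha> \<beta> \<epsilon> :: real and \<theta> :: "(real ^ 'd)" and i :: 'd
  assumes "innovation N \<U> X U"
    and "iid_copies M \<U> Us N U"
    and "0 \<le> \<alpha>" and "\<alpha> < sqrt \<beta>" and "sqrt \<beta> < 1" and "0 < \<epsilon>"
    and "in_L 5 M (\<lambda>\<omega>. ereal (innov_seq X Us \<theta> i \<omega> 0))"
    and "in_L 3 M (\<lambda>\<omega>. 1 / ereal (sqrt (V \<beta> (innov_seq X Us \<theta> i \<omega>))))"
  shows "first_order_approx_well_defined M \<beta> \<epsilon> X Us \<theta> i \<and>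
    \<bar>adam_field M \<alpha> \<beta> \<epsilon> X Us \<theta> i - first_order_approx M \<alpha> \<beta> \<epsilon> X Us \<theta> i\<bar>
      \<le> 3 / 8 * ((1 - \<alpha>) * (1 - \<beta>)\<^sup>2 / (\<beta> powr (5 / 2) * (1 - \<alpha> * \<beta>\<^sup>2))) *
        (\<integral>\<omega>. 1 / ((sqrt (V \<beta> (innov_seq X Us \<theta> i \<omega>)) + \<epsilon>)\<^sup>2 *
                 V \<beta> (innov_seq X Us \<theta> i \<omega>) powr (3 / 2)) \<partial>M) *
        (\<integral>\<omega>. \<bar>innov_seq X Us \<theta> i \<omega> 0\<bar> ^ 5 \<partial>M)"
proof -
  let ?Y = "\<lambda>k \<omega>. innov_seq X Us \<theta> i \<omega> k"
  have M: "prob_space M" and indep_Us: "prob_space.indep_vars M (\<lambda>_. \<U>) Us UNIV"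
    and law_Us: "distr M \<U> (Us k) = distr N \<U> U" for k
    using assms(2) by (auto simp: iid_copies_def)
  interpret prob_space M by (rule M)
  have X [measurable]: "X \<in> borel_measurable (\<U> \<Otimes>\<^sub>M borel)"
    using assms(1) by (simp add: innovation_def)
  have [measurable]: "Us k \<in> measurable M \<U>" for k
    using indep_Us by (auto simp: indep_vars_def)
  have "(\<lambda>u. X (u, \<theta>)) \<in> borel_measurable \<U>"
    by measurable
  then have comp [measurable]: "(\<lambda>u. X (u, \<theta>) $ i) \<in> borel_measurable \<U>"
    by (rule borel_measurable_continuous_onI[THEN measurable_compose_rev, rotated])
       (intro continuous_intros)
  \<comment> \<open>The chain \<open>0 \<le> \<alpha> < sqrt \<beta> < 1\<close> yields strict
    positivity of \<beta> as well as \<open>\<alpha> < 1\<close>.\<close>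
  have "0 < sqrt \<beta>" and \<alpha>: "\<alpha> < 1"
    using assms(3-5) by linarith+
  with assms(5) have \<beta>: "0 < \<beta>" "\<beta> < 1"
    by simp_all
  interpret iid_sequence M ?Y \<beta> \<epsilon>
  proof
    show "indep_vars (\<lambda>_. borel) ?Y UNIV"
      unfolding innov_seq_def by (rule indep_vars_compose2[OF indep_Us comp])
    show "distr M borel (?Y k) = distr M borel (?Y 0)" for k
    proof -
      \<comment> \<open>Every component is the image of the law of \<open>U\<close> under one and
        the same map.\<close>
      have "distr M borel (?Y k) = distr (distr N \<U> U) borel (\<lambda>u. X (u, \<theta>) $ i)" for k
        unfolding law_Us[of k, symmetric] by (subst distr_distr) (simp_all add: comp_def innov_seq_def[abs_def])
      from this[of k] this[of 0] show ?thesis by simp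
    qed
    show "integrable M (\<lambda>\<omega>. \<bar>?Y 0 \<omega>\<bar> ^ 5)"
    proof (rule integrableI_nonneg)
      show "(\<lambda>\<omega>. \<bar>?Y 0 \<omega>\<bar> ^ 5) \<in> borel_measurable M"
        unfolding innov_seq_def by measurable
      show "(\<integral>\<^sup>+ \<omega>. ennreal (\<bar>?Y 0 \<omega>\<bar> ^ 5) \<partial>M) < \<infinity>"
        using assms(7) by (simp add: in_L_def ennreal.abs_eq[symmetric] ennreal_power)
    qed simp
  qed (use \<beta> assms in auto)
  \<comment> \<open>As \<open>ennreal\<close> of a nonnegative real, the expectation is finite and
    \<open>enn2real\<close> recovers that real.\<close>
  have second: "second_expectation M \<beta> \<epsilon> X Us \<theta> i k = ennreal (\<integral>\<omega>. gain_slope \<epsilon> (D k \<omega>) \<partial>M)" for k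
    unfolding second_expectation_def by (rule second_expectation_gain_slope)
  have wd: "first_order_approx_well_defined M \<beta> \<epsilon> X Us \<theta> i"
    unfolding first_order_approx_well_defined_def second
    using integrable_gain_V_except integrable_power[of 1 0] integrable_power[of 3 0]
    by (simp add: gain_def)
  have sqrt_\<beta>: "\<beta> powr (5 / 2) = sqrt \<beta> ^ 5"
    using \<beta> by (simp add: powr_half_sqrt[symmetric] powr_power)
  have "adam_field M \<alpha> \<beta> \<epsilon> X Us \<theta> i = (1 - \<alpha>) * (\<integral>\<omega>. gain \<epsilon> (W \<omega>) * (\<Sum>k. \<alpha> ^ k * ?Y k \<omega>) \<partial>M)"
    by (simp add: adam_field_def gain_def)
  moreover have "first_order_approx M \<alpha> \<beta> \<epsilon> X Us \<theta> i =
      (1 - \<alpha>) * ((\<Sum>k. \<alpha> ^ k * (\<integral>\<omega>. gain \<epsilon> (D k \<omega>) \<partial>M) * (\<integral>\<omega>. ?Y 0 \<omega> \<partial>M))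
        - (1 - \<beta>) * (\<Sum>k. (\<alpha> * \<beta>) ^ k * (\<integral>\<omega>. gain_slope \<epsilon> (D k \<omega>) \<partial>M) * (\<integral>\<omega>. ?Y 0 \<omega> ^ 3 \<partial>M)))"
    unfolding first_order_approx_def second
    by (simp add: integral_gain_slope_V_except_nonneg gain_def right_diff_distrib mult.assoc)
  ultimately have "\<bar>adam_field M \<alpha> \<beta> \<epsilon> X Us \<theta> i - first_order_approx M \<alpha> \<beta> \<epsilon> X Us \<theta> i\<bar>
      = (1 - \<alpha>) * \<bar>(\<integral>\<omega>. gain \<epsilon> (W \<omega>) * (\<Sum>k. \<alpha> ^ k * ?Y k \<omega>) \<partial>M)
      - ((\<Sum>k. \<alpha> ^ k * (\<integral>\<omega>. gain \<epsilon> (D k \<omega>) \<partial>M) * (\<integral>\<omega>. ?Y 0 \<omega> \<partial>M))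
         - (1 - \<beta>) * (\<Sum>k. (\<alpha> * \<beta>) ^ k * (\<integral>\<omega>. gain_slope \<epsilon> (D k \<omega>) \<partial>M) * (\<integral>\<omega>. ?Y 0 \<omega> ^ 3 \<partial>M)))\<bar>"
    using \<alpha> by (simp only: right_diff_distrib[symmetric] abs_mult)
  also have "\<dots> \<le> (1 - \<alpha>) * (1 / (1 - \<alpha> * \<beta>\<^sup>2) * (3 / 8 * (1 - \<beta>)\<^sup>2 *
       ((1 / sqrt \<beta> ^ 5 * (\<integral>\<omega>. gain_curv \<epsilon> (W \<omega>) \<partial>M)) * (\<integral>\<omega>. \<bar>?Y 0 \<omega>\<bar> ^ 5 \<partial>M))))"
    using \<alpha> by (intro mult_left_mono first_order_approx_error assms(3)) auto
  also have "\<dots> = 3 / 8 * ((1 - \<alpha>) * (1 - \<beta>)\<^sup>2 / (\<beta> powr (5 / 2) * (1 - \<alpha> * \<beta>\<^sup>2))) *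
        (\<integral>\<omega>. gain_curv \<epsilon> (W \<omega>) \<partial>M) * (\<integral>\<omega>. \<bar>?Y 0 \<omega>\<bar> ^ 5 \<partial>M)"
    unfolding sqrt_\<beta> by (simp add: mult_ac)
  finally show ?thesis
    using wd unfolding integral_gain_curv_powr by simp
qed

end
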